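(* Almost all cographs have a generalized cospectral mate. That is, if $c_n$ denotes the number of isomorphism classes of cographs on $n$ vertices and $g_n$ the number of those isomorphism classes of cographs $G$ on $n$ vertices for which there exists a graph $H$ (not necessarily a cograph) with $H\not\cong G$, $\mathrm{Spec}(H)=\mathrm{Spec}(G)$ and $\mathrm{Spec}(\overline{H})=\mathrm{Spec}(\overline{G})$, then $g_n/c_n\to 1$ as $n\to\infty$.
   Context: A cograph is a finite simple graph obtained from the single-vertex graph by repeatedly applying disjoint union of two cographs and complementation (equivalently, a graph with no induced path on 4 vertices). $\overline{G}$ denotes the complement of $G$. For a graph $G$ with adjacency matrix $A$, $\mathrm{Spec}(G)$ is the multiset of eigenvalues of $A$. Two graphs $G,H$ are generalized cospectral if $\mathrm{Spec}(G)=\mathrm{Spec}(H)$ and $\mathrm{Spec}(\overline{G})=\mathrm{Spec}(\overline{H})$; a generalized cospectral mate of $G$ is a graph generalized cospectral with $G$ but not isomorphic to it. *)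

theory Defs
  imports "Jordan_Normal_Form.Char_Poly" "HOL-Computational_Algebra.Polynomial"
begin

text \<open>A finite simple graph on the vertex set {0..<n}, given by its adjacency relation
  (canonically False outside {0..<n}, so that there are finitely many such graphs).\<close>
definition is_graph :: "nat \<Rightarrow> (nat \<Rightarrow> nat \<Rightarrow> bool) \<Rightarrow> bool" where
  "is_graph n G \<longleftrightarrow> (\<forall>i j. G i j \<longrightarrow> i < n \<and> j < n) \<and> (\<forall>i j. G i j \<longrightarrow> G j i) \<and> (\<forall>i. \<not> G i i)"

definition graphs :: "nat \<Rightarrow> (nat \<Rightarrow> nat \<Rightarrow> bool) set" where
  "graphs n = {G. is_graph n G}"

definition complement :: "nat \<Rightarrow> (nat \<Rightarrow> nat \<Rightarrow> bool) \<Rightarrow> (nat \<Rightarrow> nat \<Rightarrow> bool)" where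
  "complement n G = (\<lambda>i j. i < n \<and> j < n \<and> i \<noteq> j \<and> \<not> G i j)"

definition graph_iso :: "nat \<Rightarrow> (nat \<Rightarrow> nat \<Rightarrow> bool) \<Rightarrow> (nat \<Rightarrow> nat \<Rightarrow> bool) \<Rightarrow> bool" where
  "graph_iso n G H \<longleftrightarrow> (\<exists>f. bij_betw f {0..<n} {0..<n} \<and>
      (\<forall>i\<in>{0..<n}. \<forall>j\<in>{0..<n}. G i j \<longleftrightarrow> H (f i) (f j)))"

definition iso_rel :: "nat \<Rightarrow> ((nat \<Rightarrow> nat \<Rightarrow> bool) \<times> (nat \<Rightarrow> nat \<Rightarrow> bool)) set" where
  "iso_rel n = {(G, H). G \<in> graphs n \<and> H \<in> graphs n \<and> graph_iso n G H}"

definition is_cograph :: "nat \<Rightarrow> (nat \<Rightarrow> nat \<Rightarrow> bool) \<Rightarrow> bool" where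
  "is_cograph n G \<longleftrightarrow> is_graph n G \<and>
     \<not> (\<exists>a b c d. a < n \<and> b < n \<and> c < n \<and> d < n \<and> distinct [a, b, c, d] \<and>
          G a b \<and> G b c \<and> G c d \<and> \<not> G a c \<and> \<not> G b d \<and> \<not> G a d)"

definition adj_matrix :: "nat \<Rightarrow> (nat \<Rightarrow> nat \<Rightarrow> bool) \<Rightarrow> complex mat" where
  "adj_matrix n G = mat n n (\<lambda>(i, j). if G i j then 1 else 0)"

definition Spec :: "nat \<Rightarrow> (nat \<Rightarrow> nat \<Rightarrow> bool) \<Rightarrow> complex multiset" where
  "Spec n G = proots (char_poly (adj_matrix n G))"

definition gen_cospectral :: "nat \<Rightarrow> (nat \<Rightarrow> nat \<Rightarrow> bool) \<Rightarrow> (nat \<Rightarrow> nat \<Rightarrow> bool) \<Rightarrow> bool" where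
  "gen_cospectral n G H \<longleftrightarrow> Spec n G = Spec n H \<and> Spec n (complement n G) = Spec n (complement n H)"

definition has_gc_mate :: "nat \<Rightarrow> (nat \<Rightarrow> nat \<Rightarrow> bool) \<Rightarrow> bool" where
  "has_gc_mate n G \<longleftrightarrow> (\<exists>H \<in> graphs n. \<not> graph_iso n G H \<and> gen_cospectral n G H)"

definition num_cographs :: "nat \<Rightarrow> nat" where
  "num_cographs n = card ({G \<in> graphs n. is_cograph n G} // iso_rel n)"

definition num_cographs_mate :: "nat \<Rightarrow> nat" where
  "num_cographs_mate n = card ({G \<in> graphs n. is_cograph n G \<and> has_gc_mate n G} // iso_rel n)"

end

theory Submission
  imports Defs "HOL-Library.Multiset" "HOL-Analysis.Uniform_Limit"
begin

text \<open>
  Isomorphism classes of finite graphs form a free commutative monoid under disjoint union, with the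
  connected classes as free generators, and for cographs on at least two vertices complementation
  exchanges connected and disconnected classes. Hence multisets of at least two connected cographs
  correspond to the connected cographs on at least two vertices, which for the number \<open>t n\<close>
  of connected cographs gives the identity \<open>2 T(x) + 1 - x = (\<Prod>n. (1 - x^n) powr - t n)\<close>
  for \<open>T(x) = (\<Sum>n. t n x^n)\<close> inside the radius of convergence \<open>\<rho>\<close>.

  Call a graph mated if some Godsil--McKay switching turns it into a graph that is not a cograph.
  Switching preserves both spectra, so a mated cograph has a generalized cospectral mate, and being
  mated is inherited by complements and by disjoint unions with arbitrary graphs. A smallest mated
  cograph (one with 11 vertices exists), on \<open>m\<close> vertices say, therefore gives a multiset
  that is lost in the count of the unmated connected cographs: with \<open>w n\<close> of these and
  \<open>W(x) = (\<Sum>n. w n x^n)\<close>, only \<open>2 W(x) + 1 - x + x^m \<le> (\<Prod>n. (1 - x^n) powr - w n)\<close>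
  remains. The summand \<open>x^m\<close> leaves room at \<open>\<rho>\<close>: the partial
  sums of the unmated series stay bounded by \<open>T(\<rho>)\<close> at some point beyond
  \<open>\<rho>\<close>, so unmated cographs are exponentially rarer than all cographs.
\<close>

section \<open>Isomorphism classes of finite graphs\<close>

text \<open>Nothing is asked of \<open>E\<close> outside \<open>V\<close>, so an induced subgraph is
  the same relation on a smaller vertex set.\<close>

definition fgraph :: "nat set \<Rightarrow> (nat \<Rightarrow> nat \<Rightarrow> bool) \<Rightarrow> bool" where
  "fgraph V E \<longleftrightarrow> finite V \<and> (\<forall>i\<in>V. \<not> E i i) \<and> (\<forall>i\<in>V. \<forall>j\<in>V. E i j \<longrightarrow> E j i)"

definition iso_via :: "(nat \<Rightarrow> nat) \<Rightarrow> nat set \<Rightarrow> (nat \<Rightarrow> nat \<Rightarrow> bool) \<Rightarrow>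
    nat set \<Rightarrow> (nat \<Rightarrow> nat \<Rightarrow> bool) \<Rightarrow> bool" where
  "iso_via f V E W F \<longleftrightarrow> bij_betw f V W \<and> (\<forall>i\<in>V. \<forall>j\<in>V. E i j \<longleftrightarrow> F (f i) (f j))"

lemma iso_via_refl: "iso_via id V E V E"
  by (auto simp: iso_via_def)

lemma iso_via_trans: "iso_via f V E W F \<Longrightarrow> iso_via g W F U G \<Longrightarrow> iso_via (g \<circ> f) V E U G"
  unfolding iso_via_def using bij_betw_trans[of f V W g U] bij_betwE[of f V W] by simp

lemma iso_via_inv:
  assumes "iso_via f V E W F"
  shows "iso_via (inv_into V f) W F V E"
proof -
  have f: "bij_betw f V W" and E: "\<And>i j. i \<in> V \<Longrightarrow> j \<in> V \<Longrightarrow> E i j \<longleftrightarrow> F (f i) (f j)"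
    using assms by (auto simp: iso_via_def)
  have "inv_into V f i \<in> V" "f (inv_into V f i) = i" if "i \<in> W" for i
    using f that by (auto simp: bij_betw_def inv_into_into f_inv_into_f)
  then show ?thesis using E bij_betw_inv_into[OF f] by (simp add: iso_via_def)
qed

lemma iso_via_subset: "iso_via f V E W F \<Longrightarrow> X \<subseteq> V \<Longrightarrow> iso_via f X E (f ` X) F"
  by (auto simp: iso_via_def bij_betw_def inj_on_subset)

lemma fgraph_subset: "fgraph V E \<Longrightarrow> X \<subseteq> V \<Longrightarrow> fgraph X E"
  by (auto simp: fgraph_def finite_subset)

lemma fgraph_cong: "(\<And>i j. i \<in> V \<Longrightarrow> j \<in> V \<Longrightarrow> E i j = F i j) \<Longrightarrow> fgraph V E = fgraph V F"
  by (auto simp: fgraph_def)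

text \<open>Pairs that are not graphs are related to nothing, not even to themselves, which makes
  this a partial equivalence.\<close>

definition giso :: "nat set \<times> (nat \<Rightarrow> nat \<Rightarrow> bool) \<Rightarrow> nat set \<times> (nat \<Rightarrow> nat \<Rightarrow> bool) \<Rightarrow> bool" where
  "giso p q \<longleftrightarrow> fgraph (fst p) (snd p) \<and> fgraph (fst q) (snd q) \<and>
     (\<exists>f. iso_via f (fst p) (snd p) (fst q) (snd q))"

quotient_type gclass = "nat set \<times> (nat \<Rightarrow> nat \<Rightarrow> bool)" / partial: giso
proof (rule part_equivpI)
  show "\<exists>x. giso x x"
    by (auto simp: giso_def fgraph_def iso_via_def intro!: exI[of _ "{}"])
  show "symp giso" using iso_via_inv unfolding symp_def giso_def by blast
  show "transp giso" using iso_via_trans unfolding transp_def giso_def by blast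
qed

definition cls :: "nat set \<Rightarrow> (nat \<Rightarrow> nat \<Rightarrow> bool) \<Rightarrow> gclass" where
  "cls V E = abs_gclass (V, E)"

lemma giso_refl: "fgraph V E \<Longrightarrow> giso (V, E) (V, E)"
  using iso_via_refl by (auto simp: giso_def)

lemma cls_eq_iff:
  assumes "fgraph V E" "fgraph W F"
  shows "cls V E = cls W F \<longleftrightarrow> (\<exists>f. iso_via f V E W F)"
proof -
  have "giso (V, E) (W, F) \<longleftrightarrow> cls V E = cls W F"
    using Quotient3_rel[OF Quotient3_gclass, of "(V, E)" "(W, F)"] giso_refl assms
    unfolding cls_def by blast
  then show ?thesis using assms by (simp add: giso_def)
qed

lemma cls_cong:
  assumes "fgraph V E" "\<And>i j. i \<in> V \<Longrightarrow> j \<in> V \<Longrightarrow> E i j = F i j"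
  shows "cls V E = cls V F"
proof -
  have "fgraph V F" using assms fgraph_cong by blast
  moreover have "iso_via id V E V F" using assms(2) by (simp add: iso_via_def)
  ultimately show ?thesis using assms(1) cls_eq_iff by blast
qed

lemma gclass_exhaust:
  obtains V E where "fgraph V E" "c = cls V E"
proof -
  obtain V E where VE: "rep_gclass c = (V, E)" by (cases "rep_gclass c")
  have "giso (rep_gclass c) (rep_gclass c)" using Quotient3_rep_reflp[OF Quotient3_gclass] .
  moreover have "abs_gclass (rep_gclass c) = c" using Quotient3_abs_rep[OF Quotient3_gclass] .
  ultimately show ?thesis using that[of V E] VE by (simp add: giso_def cls_def)
qed

lemma iso_via_fgraph:
  assumes "iso_via f V E W F" "fgraph V E"
  shows "fgraph W F"
proof -
  have W: "W = f ` V" and E: "\<And>i j. i \<in> V \<Longrightarrow> j \<in> V \<Longrightarrow> F (f i) (f j) \<longleftrightarrow> E i j"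
    using assms(1) by (simp_all add: iso_via_def bij_betw_def)
  show ?thesis using assms(2) unfolding W fgraph_def by (simp add: E)
qed

text \<open>Shifting all vertices past an upper bound of \<open>X\<close> gives the copy. Disjoint
  unions of arbitrary classes rest on this.\<close>

lemma fresh_copy:
  assumes "finite X"
  obtains V E where "fgraph V E" "V \<inter> X = {}" "cls V E = c"
proof -
  obtain V E where VE: "fgraph V E" "c = cls V E" by (rule gclass_exhaust)
  obtain m where m: "\<forall>x\<in>X. x < m"
    using finite_nat_set_iff_bounded assms by blast
  let ?E = "\<lambda>i j. E (i - m) (j - m)"
  have iso: "iso_via (\<lambda>i. i + m) V E ((\<lambda>i. i + m) ` V) ?E"
    unfolding iso_via_def by (intro conjI inj_on_imp_bij_betw) auto
  then have f: "fgraph ((\<lambda>i. i + m) ` V) ?E" using VE iso_via_fgraph by blast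
  moreover have "((\<lambda>i. i + m) ` V) \<inter> X = {}"
  proof -
    have "i + m \<notin> X" for i using m by auto
    then show ?thesis by blast
  qed
  moreover have "cls V E = cls ((\<lambda>i. i + m) ` V) ?E"
    using cls_eq_iff[OF VE(1) f] iso by blast
  then have "cls ((\<lambda>i. i + m) ` V) ?E = c" using VE by simp
  ultimately show ?thesis using that by blast
qed

section \<open>Disjoint union as a commutative monoid on isomorphism classes\<close>

definition gsplit :: "nat set \<Rightarrow> (nat \<Rightarrow> nat \<Rightarrow> bool) \<Rightarrow> nat set \<Rightarrow> nat set \<Rightarrow> bool" where
  "gsplit V E X Y \<longleftrightarrow> fgraph V E \<and> V = X \<union> Y \<and> X \<inter> Y = {} \<and> (\<forall>i\<in>X. \<forall>j\<in>Y. \<not> E i j)"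

lemma gsplitD:
  assumes "gsplit V E X Y"
  shows "fgraph V E" "fgraph X E" "fgraph Y E" "V = X \<union> Y" "X \<inter> Y = {}"
    "\<And>i j. i \<in> X \<Longrightarrow> j \<in> Y \<Longrightarrow> \<not> E i j" "\<And>i j. i \<in> X \<Longrightarrow> j \<in> Y \<Longrightarrow> \<not> E j i"
proof -
  have g: "fgraph V E" "V = X \<union> Y" "X \<inter> Y = {}" "\<forall>i\<in>X. \<forall>j\<in>Y. \<not> E i j"
    using assms unfolding gsplit_def by iprover+
  show "fgraph V E" "V = X \<union> Y" "X \<inter> Y = {}" by fact+
  show E: "\<And>i j. i \<in> X \<Longrightarrow> j \<in> Y \<Longrightarrow> \<not> E i j" using g(4) by blast
  show "fgraph X E" "fgraph Y E" by (rule fgraph_subset[OF g(1)], simp add: g(2))+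
  show "\<not> E j i" if "i \<in> X" "j \<in> Y" for i j
  proof -
    have "i \<in> V" "j \<in> V" using that g(2) by simp_all
    then show ?thesis using E[OF that] g(1) unfolding fgraph_def by blast
  qed
qed

lemma gsplit_sym:
  assumes "gsplit V E X Y"
  shows "gsplit V E Y X"
  using gsplitD(1,7)[OF assms] gsplitD(4,5)[OF assms] unfolding gsplit_def by blast

lemma gsplit_restrict:
  assumes "gsplit V E X Y" "U \<subseteq> V"
  shows "gsplit U E (U \<inter> X) (U \<inter> Y)"
  using gsplitD(4-6)[OF assms(1)] fgraph_subset[OF gsplitD(1)[OF assms(1)] assms(2)] assms(2)
  unfolding gsplit_def by blast

text \<open>No edges run between the two parts of either graph, so isomorphisms of the parts can be
  glued.\<close>

lemma gsplit_iso:
  assumes "gsplit V E X Y" "gsplit W F X' Y'" "iso_via f X E X' F" "iso_via g Y E Y' F"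
  shows "\<exists>h. iso_via h V E W F"
proof -
  note d = gsplitD[OF assms(1)] and d' = gsplitD[OF assms(2)]
  let ?h = "\<lambda>i. if i \<in> X then f i else g i"
  have "bij_betw ?h V W"
    unfolding d(4) d'(4) using assms(3,4) d(5) d'(5)
    by (intro bij_betw_disjoint_Un) (auto simp: iso_via_def)
  moreover have "E i j = F (?h i) (?h j)" if "i \<in> V" "j \<in> V" for i j
  proof -
    have f: "k \<in> X \<Longrightarrow> f k \<in> X'" and g: "k \<in> Y \<Longrightarrow> g k \<in> Y'" for k
      using assms(3,4) by (auto simp: iso_via_def dest: bij_betwE)
    have X: "k \<in> X \<Longrightarrow> ?h k = f k" and Y: "k \<in> Y \<Longrightarrow> ?h k = g k" for k
      using d(5) by auto
    consider "i \<in> X" "j \<in> X" | "i \<in> X" "j \<in> Y" | "i \<in> Y" "j \<in> X" | "i \<in> Y" "j \<in> Y"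
      using \<open>i \<in> V\<close> \<open>j \<in> V\<close> d(4) by blast
    then show ?thesis
    proof cases
      case 1 then show ?thesis using assms(3) by (simp add: iso_via_def)
    next
      case 2 then show ?thesis using d(6) d'(6) f g X Y by metis
    next
      case 3 then show ?thesis using d(7) d'(7) f g X Y by metis
    next
      case 4 then show ?thesis using assms(4) Y by (simp add: iso_via_def)
    qed
  qed
  ultimately show ?thesis unfolding iso_via_def by blast
qed

lemma gsplit_ex:
  obtains V E X Y where "gsplit V E X Y" "cls X E = a" "cls Y E = b"
proof -
  obtain X F where X: "fgraph X F" "a = cls X F" by (rule gclass_exhaust)
  then have "finite X" by (simp add: fgraph_def)
  then obtain Y G where Y: "fgraph Y G" "Y \<inter> X = {}" "cls Y G = b" by (rule fresh_copy)
  let ?E = "\<lambda>i j. i \<in> X \<and> j \<in> X \<and> F i j \<or> i \<in> Y \<and> j \<in> Y \<and> G i j"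
  have "fgraph (X \<union> Y) ?E" using X(1) Y(1) unfolding fgraph_def by blast
  then have "gsplit (X \<union> Y) ?E X Y" using Y(2) unfolding gsplit_def by blast
  moreover have "cls X ?E = a"
    unfolding X(2) using X(1) Y(1,2) by (intro cls_cong[symmetric]) auto
  moreover have "cls Y ?E = b"
    unfolding Y(3)[symmetric] using X(1) Y(1,2) by (intro cls_cong[symmetric]) auto
  ultimately show ?thesis using that by blast
qed

instantiation gclass :: comm_monoid_add
begin

definition zero_gclass :: gclass where "0 = cls {} (\<lambda>_ _. False)"

definition plus_gclass :: "gclass \<Rightarrow> gclass \<Rightarrow> gclass" where
  "a + b = (THE c. \<exists>V E X Y. gsplit V E X Y \<and> cls X E = a \<and> cls Y E = b \<and> c = cls V E)"

text \<open>Isomorphic parts have isomorphic unions by \<open>gsplit_iso\<close>, so the description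
  in \<open>plus_gclass\<close> has exactly one solution.\<close>

lemma cls_gsplit:
  assumes "gsplit V E X Y"
  shows "cls V E = cls X E + cls Y E"
  unfolding plus_gclass_def
proof (rule the_equality[symmetric])
  show "\<exists>V' E' X' Y'. gsplit V' E' X' Y' \<and> cls X' E' = cls X E \<and> cls Y' E' = cls Y E \<and> cls V E = cls V' E'"
    using assms by blast
next
  fix c assume "\<exists>V' E' X' Y'. gsplit V' E' X' Y' \<and> cls X' E' = cls X E \<and> cls Y' E' = cls Y E \<and> c = cls V' E'"
  then obtain V' E' X' Y' where
    s: "gsplit V' E' X' Y'" "cls X' E' = cls X E" "cls Y' E' = cls Y E" "c = cls V' E'" by blast
  then have "\<exists>f. iso_via f X' E' X E" "\<exists>f. iso_via f Y' E' Y E"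
    using gsplitD[OF s(1)] gsplitD[OF assms] cls_eq_iff by metis+
  then have "\<exists>h. iso_via h V' E' V E" using gsplit_iso s(1) assms by blast
  then show "c = cls V E"
    using gsplitD[OF s(1)] gsplitD[OF assms] s(4) cls_eq_iff by simp
qed

text \<open>A split of some representative is carried to the given graph along an isomorphism.
  Algebraic decompositions thus become vertex partitions of any chosen representative.\<close>

lemma gsplit_plusE:
  assumes "fgraph V E" "cls V E = a + b"
  obtains X Y where "gsplit V E X Y" "cls X E = a" "cls Y E = b"
proof -
  obtain W F X Y where s: "gsplit W F X Y" "cls X F = a" "cls Y F = b" by (rule gsplit_ex)
  note d = gsplitD[OF s(1)]
  have "cls W F = cls V E" using cls_gsplit[OF s(1)] s assms by simp
  then obtain f where f: "iso_via f W F V E" using d assms cls_eq_iff by blast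
  have "gsplit V E (f ` X) (f ` Y)"
    unfolding gsplit_def
  proof (intro conjI)
    show "V = f ` X \<union> f ` Y" using f d(4) by (auto simp: iso_via_def bij_betw_def)
    show "f ` X \<inter> f ` Y = {}"
      using f d(4,5) unfolding iso_via_def bij_betw_def inj_on_def by blast
    show "\<forall>i\<in>f ` X. \<forall>j\<in>f ` Y. \<not> E i j"
      using f d(4,6) unfolding iso_via_def by auto
  qed (rule assms)
  moreover have "cls (f ` X) E = a" "cls (f ` Y) E = b"
    using iso_via_subset[OF f, of X] iso_via_subset[OF f, of Y] d s(2,3)
      gsplitD(2,3)[OF \<open>gsplit V E (f ` X) (f ` Y)\<close>] cls_eq_iff by (metis Un_upper1 Un_upper2)+
  ultimately show ?thesis using that by blast
qed

instance (* INST *)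
proof
  fix a b c :: gclass
  obtain V E U Z where s: "gsplit V E U Z" "cls U E = a + b" "cls Z E = c" by (rule gsplit_ex)
  note d = gsplitD[OF s(1)]
  obtain X Y where s': "gsplit U E X Y" "cls X E = a" "cls Y E = b"
    using gsplit_plusE[OF d(2) s(2)] by blast
  note d' = gsplitD[OF s'(1)]
  have 1: "gsplit V E X (Y \<union> Z)" "gsplit (Y \<union> Z) E Y Z"
    using d d' fgraph_subset[OF d(1), of "Y \<union> Z"] by (auto simp: gsplit_def)
  have "a + b + c = cls V E" using cls_gsplit[OF s(1)] s by simp
  also have "\<dots> = a + (b + c)" using cls_gsplit[OF 1(1)] cls_gsplit[OF 1(2)] s' s by simp
  finally show "a + b + c = a + (b + c)" .
next
  fix a b :: gclass
  obtain V E X Y where s: "gsplit V E X Y" "cls X E = a" "cls Y E = b" by (rule gsplit_ex)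
  then show "a + b = b + a"
    using cls_gsplit[OF s(1)] cls_gsplit[OF gsplit_sym[OF s(1)]] by simp
next
  fix a :: gclass
  obtain V E where VE: "fgraph V E" "a = cls V E" by (rule gclass_exhaust)
  have "gsplit V E {} V" using VE by (simp add: gsplit_def)
  then have "cls V E = cls {} E + cls V E" by (rule cls_gsplit)
  moreover have "cls {} E = 0"
    unfolding zero_gclass_def by (intro cls_cong) (auto simp: fgraph_def)
  ultimately show "0 + a = a" using VE by simp
qed

end

section \<open>Number of vertices and complementation on isomorphism classes\<close>

lift_definition gsize :: "gclass \<Rightarrow> nat" is "\<lambda>(V, E). card V"
  by (auto simp: giso_def iso_via_def bij_betw_same_card)

text \<open>No vertex set is mentioned, so complementation commutes with passing to induced
  subgraphs.\<close>

definition compl_rel :: "(nat \<Rightarrow> nat \<Rightarrow> bool) \<Rightarrow> nat \<Rightarrow> nat \<Rightarrow> bool" where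
  "compl_rel E = (\<lambda>i j. i \<noteq> j \<and> \<not> E i j)"

lemma fgraph_compl: "fgraph V E \<Longrightarrow> fgraph V (compl_rel E)"
  by (auto simp: fgraph_def compl_rel_def)

lemma iso_via_compl:
  assumes "iso_via f V E W F"
  shows "iso_via f V (compl_rel E) W (compl_rel F)"
proof -
  have "inj_on f V" using assms by (auto simp: iso_via_def bij_betw_def)
  then have "f i = f j \<longleftrightarrow> i = j" if "i \<in> V" "j \<in> V" for i j
    using that by (auto dest: inj_onD)
  then show ?thesis using assms by (simp add: iso_via_def compl_rel_def)
qed

lift_definition co :: "gclass \<Rightarrow> gclass" is "\<lambda>(V, E). (V, compl_rel E)"
proof -
  fix p q :: "nat set \<times> (nat \<Rightarrow> nat \<Rightarrow> bool)" assume "giso p q"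
  moreover obtain V E W F where "p = (V, E)" "q = (W, F)" by (cases p; cases q) blast
  ultimately show "giso (case p of (V, E) \<Rightarrow> (V, compl_rel E)) (case q of (V, E) \<Rightarrow> (V, compl_rel E))"
    using fgraph_compl[of V E] fgraph_compl[of W F] iso_via_compl[of _ V E W F]
    by (simp add: giso_def) blast
qed

lemma gsize_cls: "fgraph V E \<Longrightarrow> gsize (cls V E) = card V"
  using gsize.abs_eq[OF giso_refl] by (simp add: cls_def)

lemma co_cls: "fgraph V E \<Longrightarrow> co (cls V E) = cls V (compl_rel E)"
  using co.abs_eq[OF giso_refl] by (simp add: cls_def)

lemma co_co [simp]: "co (co c) = c"
proof -
  obtain V E where VE: "fgraph V E" "c = cls V E" by (rule gclass_exhaust)
  have "cls V E = cls V (compl_rel (compl_rel E))"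
    using VE(1) by (rule cls_cong) (use VE(1) in \<open>auto simp: fgraph_def compl_rel_def\<close>)
  then show ?thesis using VE fgraph_compl co_cls by metis
qed

lemma gsize_co [simp]: "gsize (co c) = gsize c"
proof -
  obtain V E where "fgraph V E" "c = cls V E" by (rule gclass_exhaust)
  then show ?thesis using fgraph_compl[of V E] by (simp add: co_cls gsize_cls)
qed

lemma gsize_plus [simp]: "gsize (a + b) = gsize a + gsize b"
proof -
  obtain V E X Y where s: "gsplit V E X Y" "cls X E = a" "cls Y E = b" by (rule gsplit_ex)
  note d = gsplitD[OF s(1)]
  have "card V = card X + card Y" using d(2,3,5) unfolding d(4) fgraph_def by (intro card_Un_disjoint) simp_all
  then show ?thesis
    using gsize_cls[OF d(1)] gsize_cls[OF d(2)] gsize_cls[OF d(3)] s(2,3)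
    by (simp add: cls_gsplit[OF s(1)])
qed

lemma gsize_eq_0_iff [simp]: "gsize c = 0 \<longleftrightarrow> c = 0"
proof -
  obtain V E where VE: "fgraph V E" "c = cls V E" by (rule gclass_exhaust)
  have e: "fgraph {} (\<lambda>_ _. False)" by (simp add: fgraph_def)
  show ?thesis
  proof
    assume "gsize c = 0"
    then have "V = {}" using VE gsize_cls by (auto simp: fgraph_def)
    then show "c = 0" using VE unfolding zero_gclass_def by (auto intro: cls_cong)
  qed (use e in \<open>simp add: zero_gclass_def gsize_cls\<close>)
qed

lemma gsize_0 [simp]: "gsize 0 = 0" by simp

section \<open>Unique decomposition into connected classes\<close>

definition gconnected :: "gclass \<Rightarrow> bool" where
  "gconnected c \<longleftrightarrow> c \<noteq> 0 \<and> (\<forall>a b. c = a + b \<longrightarrow> a = 0 \<or> b = 0)"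

text \<open>A class that is neither zero nor connected is a sum of two nonzero, hence smaller,
  classes.\<close>

lemma ex_connected_sum: "\<exists>M. (\<forall>s\<in>#M. gconnected s) \<and> c = sum_mset M"
proof (induction "gsize c" arbitrary: c rule: less_induct)
  case less
  show ?case
  proof (cases "c = 0 \<or> gconnected c")
    case True
    then show ?thesis by (auto intro: exI[of _ "{#}"] exI[of _ "{#c#}"])
  next
    case False
    then obtain a b where ab: "c = a + b" "a \<noteq> 0" "b \<noteq> 0" by (auto simp: gconnected_def)
    then have "gsize a \<noteq> 0" "gsize b \<noteq> 0" by simp_all
    then have "gsize a < gsize c" "gsize b < gsize c" unfolding ab(1) gsize_plus by linarith+
    then obtain M N where "(\<forall>s\<in>#M. gconnected s) \<and> a = sum_mset M" "(\<forall>s\<in>#N. gconnected s) \<and> b = sum_mset N"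
      using less by meson
    then show ?thesis using ab by (intro exI[of _ "M + N"]) auto
  qed
qed

lemma cls_eq_0: "fgraph V E \<Longrightarrow> cls V E = 0 \<longleftrightarrow> V = {}"
  using gsize_eq_0_iff[of "cls V E"] by (simp add: gsize_cls fgraph_def del: gsize_eq_0_iff)

lemma connected_gsplit:
  assumes "gconnected (cls V E)" "gsplit V E X Y"
  shows "X = {} \<or> Y = {}"
  using assms cls_gsplit[OF assms(2)] gsplitD(2,3)[OF assms(2)] by (metis gconnected_def cls_eq_0)

text \<open>Both sums are realised as partitions of one vertex set. A connected part cannot be cut
  by the other partition, so the two connected parts coincide or are disjoint; in the latter case
  \<open>z\<close> is the class of what lies outside both.\<close>

lemma connected_refine:
  assumes "gconnected s" "gconnected s'" "s + x = s' + y"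
  shows "s = s' \<and> x = y \<or> (\<exists>z. x = s' + z \<and> y = s + z)"
proof -
  obtain V E S X where s: "gsplit V E S X" "cls S E = s" "cls X E = x" by (rule gsplit_ex)
  note d = gsplitD[OF s(1)]
  have "cls V E = s' + y" using cls_gsplit[OF s(1)] s assms(3) by simp
  then obtain S' Y where s': "gsplit V E S' Y" "cls S' E = s'" "cls Y E = y"
    using gsplit_plusE d(1) by blast
  note d' = gsplitD[OF s'(1)]
  have "S \<subseteq> V" "S' \<subseteq> V" "X \<subseteq> V" "Y \<subseteq> V" using d(4) d'(4) by blast+
  note restrict = gsplit_restrict[OF s'(1) \<open>S \<subseteq> V\<close>] gsplit_restrict[OF s(1) \<open>S' \<subseteq> V\<close>]
    gsplit_restrict[OF s'(1) \<open>X \<subseteq> V\<close>] gsplit_restrict[OF s(1) \<open>Y \<subseteq> V\<close>]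
  have 1: "S \<inter> S' = {} \<or> S \<inter> Y = {}"
    using connected_gsplit[OF _ restrict(1)] assms(1) s(2) by blast
  have 2: "S' \<inter> S = {} \<or> S' \<inter> X = {}"
    using connected_gsplit[OF _ restrict(2)] assms(2) s'(2) by blast
  show ?thesis
  proof (cases "S \<inter> S' = {}")
    case False
    then have "S = S'" using 1 2 d(4) d'(4) by blast
    moreover from this have "X = Y" using d(4,5) d'(4,5) by blast
    ultimately show ?thesis using s(2,3) s'(2,3) by simp
  next
    case True
    let ?Z = "X \<inter> Y"
    have "X \<inter> S' = S'" "Y \<inter> S = S" "Y \<inter> X = ?Z" using True d(4,5) d'(4,5) by blast+
    then have "gsplit X E S' ?Z" "gsplit Y E S ?Z" using restrict(3,4) by simp_all
    then have "x = s' + cls ?Z E" "y = s + cls ?Z E"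
      using cls_gsplit s(2,3) s'(2,3) by blast+
    then show ?thesis by blast
  qed
qed

lemma plus_eq_0_iff: "(a :: gclass) + b = 0 \<longleftrightarrow> a = 0 \<and> b = 0"
  using gsize_eq_0_iff[of "a + b"] gsize_eq_0_iff[of a] gsize_eq_0_iff[of b]
  unfolding gsize_plus by fastforce

lemma connected_sum_eq_0:
  assumes "\<forall>s\<in>#M. gconnected s" "sum_mset M = 0"
  shows "M = {#}"
proof (cases M)
  case (add s M')
  then have "s = 0" "gconnected s" using assms by (auto simp: plus_eq_0_iff)
  then show ?thesis by (simp add: gconnected_def)
qed

text \<open>An exchange argument: if the chosen components cannot be cancelled, then by
  \<open>connected_refine\<close> each of them occurs in the other remainder, with a common rest
  \<open>L\<close>.\<close>

lemma connected_sum_unique: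
  assumes "\<forall>s\<in>#M. gconnected s" "\<forall>s\<in>#N. gconnected s" "sum_mset M = sum_mset N"
  shows "M = N"
  using assms
proof (induction "size M" arbitrary: M N rule: less_induct)
  case less
  show ?case
  proof (cases "M = {#} \<or> N = {#}")
    case True
    then have "sum_mset M = 0" "sum_mset N = 0" using less.prems(3) by auto
    then show ?thesis using less.prems(1,2) connected_sum_eq_0 by blast
  next
    case False
    then obtain s M' s' N' where MN: "M = add_mset s M'" "N = add_mset s' N'"
      by (meson multi_nonempty_split)
    then have c: "gconnected s" "gconnected s'" "s + sum_mset M' = s' + sum_mset N'"
      "\<forall>s\<in>#M'. gconnected s" "\<forall>s\<in>#N'. gconnected s"
      using less.prems by auto
    show ?thesis
    proof (cases "s = s' \<and> sum_mset M' = sum_mset N'")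
      case True
      then have "M' = N'" using c MN by (intro less) auto
      then show ?thesis using MN True by simp
    next
      case False
      then obtain z where z: "sum_mset M' = s' + z" "sum_mset N' = s + z"
        using connected_refine[OF c(1-3)] by blast
      obtain L where L: "\<forall>s\<in>#L. gconnected s" "z = sum_mset L" using ex_connected_sum by blast
      \<comment> \<open>The hypothesis is applied to \<open>M'\<close> first; this gives the size of
        \<open>add_mset s L\<close>, which the second application needs.\<close>
      have M': "M' = add_mset s' L" using c MN L z by (intro less) auto
      then have "sum_mset (add_mset s L) = sum_mset N'" using z L by simp
      moreover have "size (add_mset s L) < size M" using M' MN by simp
      ultimately have "add_mset s L = N'" using c MN L by (intro less) auto
      then show ?thesis using M' MN by simp
    qed
  qed
qed

section \<open>Cographs\<close>

lemma compl_compl: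
  "fgraph V E \<Longrightarrow> i \<in> V \<Longrightarrow> j \<in> V \<Longrightarrow> compl_rel (compl_rel E) i j \<longleftrightarrow> E i j"
  by (auto simp: compl_rel_def fgraph_def)

definition P4_at :: "(nat \<Rightarrow> nat \<Rightarrow> bool) \<Rightarrow> nat \<Rightarrow> nat \<Rightarrow> nat \<Rightarrow> nat \<Rightarrow> bool" where
  "P4_at E a b c d \<longleftrightarrow> distinct [a, b, c, d] \<and>
     E a b \<and> E b c \<and> E c d \<and> \<not> E a c \<and> \<not> E b d \<and> \<not> E a d"

definition P4_free :: "nat set \<Rightarrow> (nat \<Rightarrow> nat \<Rightarrow> bool) \<Rightarrow> bool" where
  "P4_free V E \<longleftrightarrow> (\<forall>a\<in>V. \<forall>b\<in>V. \<forall>c\<in>V. \<forall>d\<in>V. \<not> P4_at E a b c d)"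

lemma P4_free_subset: "P4_free V E \<Longrightarrow> X \<subseteq> V \<Longrightarrow> P4_free X E"
  unfolding P4_free_def by blast

lemma P4_free_iso:
  assumes "iso_via f V E W F" "P4_free W F"
  shows "P4_free V E"
  unfolding P4_free_def
proof (intro ballI)
  fix a b c d assume V: "a \<in> V" "b \<in> V" "c \<in> V" "d \<in> V"
  have E: "E i j \<longleftrightarrow> F (f i) (f j)" if "i \<in> V" "j \<in> V" for i j
    using assms(1) that by (simp add: iso_via_def)
  have bij: "bij_betw f V W" using assms(1) by (simp add: iso_via_def)
  then have inj: "f i = f j \<longleftrightarrow> i = j" if "i \<in> V" "j \<in> V" for i j
    using that by (auto simp: bij_betw_def dest: inj_onD)
  have "f a \<in> W" "f b \<in> W" "f c \<in> W" "f d \<in> W" using bij V by (auto dest: bij_betwE)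
  then have "\<not> P4_at F (f a) (f b) (f c) (f d)" using assms(2) unfolding P4_free_def by blast
  then show "\<not> P4_at E a b c d" by (simp add: P4_at_def E V inj)
qed

lemma P4_free_cong:
  assumes "\<And>i j. i \<in> V \<Longrightarrow> j \<in> V \<Longrightarrow> E i j = F i j"
  shows "P4_free V E = P4_free V F"
  using assms by (simp add: P4_free_def P4_at_def)

text \<open>Each edge of a path stays on one side of the split, so all four vertices do.\<close>

lemma P4_free_gsplit:
  assumes "gsplit V E X Y" "P4_free X E" "P4_free Y E"
  shows "P4_free V E"
  unfolding P4_free_def
proof (intro ballI notI)
  fix a b c d assume V: "a \<in> V" "b \<in> V" "c \<in> V" "d \<in> V" and P: "P4_at E a b c d"
  note d = gsplitD[OF assms(1)]
  have step: "j \<in> X \<longleftrightarrow> i \<in> X" if "E i j" "i \<in> V" "j \<in> V" for i j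
    using that d(4-7) by blast
  have eq: "b \<in> X \<longleftrightarrow> a \<in> X" "c \<in> X \<longleftrightarrow> a \<in> X" "d \<in> X \<longleftrightarrow> a \<in> X"
    using P V step unfolding P4_at_def by metis+
  show False
  proof (cases "a \<in> X")
    case True
    then show False using eq P assms(2) unfolding P4_free_def by blast
  next
    case False
    then have "a \<in> Y" "b \<in> Y" "c \<in> Y" "d \<in> Y" using eq V d(4) by auto
    then show False using P assms(3) unfolding P4_free_def by blast
  qed
qed

text \<open>The path on four vertices is self-complementary: a path \<open>a\<close>,
  \<open>b\<close>, \<open>c\<close>, \<open>d\<close> of the complement is the path
  \<open>b\<close>, \<open>d\<close>, \<open>a\<close>, \<open>c\<close> of the graph.\<close>

lemma P4_free_compl_aux:
  assumes "fgraph V E" "P4_free V E"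
  shows "P4_free V (compl_rel E)"
  unfolding P4_free_def
proof (intro ballI notI)
  fix a b c d assume V: "a \<in> V" "b \<in> V" "c \<in> V" "d \<in> V" and P: "P4_at (compl_rel E) a b c d"
  have "E i j = E j i" if "i \<in> V" "j \<in> V" for i j
    using assms(1) that unfolding fgraph_def by blast
  then have "P4_at E b d a c" using P V by (auto simp: P4_at_def compl_rel_def)
  then show False using V assms(2) unfolding P4_free_def by blast
qed

lemma P4_free_compl:
  assumes "fgraph V E"
  shows "P4_free V (compl_rel E) \<longleftrightarrow> P4_free V E"
  using P4_free_compl_aux[OF assms] P4_free_compl_aux[OF fgraph_compl[OF assms]]
    P4_free_cong[of V "compl_rel (compl_rel E)" E] compl_compl[OF assms] by blast

definition cograph :: "gclass \<Rightarrow> bool" where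
  "cograph c \<longleftrightarrow> (\<exists>V E. fgraph V E \<and> c = cls V E \<and> P4_free V E)"

lemma cograph_cls:
  assumes "fgraph V E"
  shows "cograph (cls V E) \<longleftrightarrow> P4_free V E"
proof
  assume "cograph (cls V E)"
  then obtain W F where W: "fgraph W F" "cls V E = cls W F" "P4_free W F"
    unfolding cograph_def by blast
  then obtain f where "iso_via f V E W F" using cls_eq_iff[OF assms W(1)] by blast
  then show "P4_free V E" using W(3) by (rule P4_free_iso)
next
  assume "P4_free V E"
  then show "cograph (cls V E)" using assms unfolding cograph_def by blast
qed

lemma cograph_plus [simp]: "cograph (a + b) \<longleftrightarrow> cograph a \<and> cograph b"
proof -
  obtain V E X Y where s: "gsplit V E X Y" "cls X E = a" "cls Y E = b" by (rule gsplit_ex)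
  note d = gsplitD[OF s(1)]
  have ab: "a + b = cls V E" using cls_gsplit[OF s(1)] s(2,3) by simp
  have "X \<subseteq> V" "Y \<subseteq> V" using d(4) by simp_all
  then have "P4_free V E \<longleftrightarrow> P4_free X E \<and> P4_free Y E"
    using P4_free_gsplit[OF s(1)] P4_free_subset by blast
  then show ?thesis
    unfolding ab cograph_cls[OF d(1)] using cograph_cls[OF d(2)] cograph_cls[OF d(3)] s(2,3) by simp
qed

lemma cograph_co [simp]: "cograph (co c) \<longleftrightarrow> cograph c"
proof -
  obtain V E where VE: "fgraph V E" "c = cls V E" by (rule gclass_exhaust)
  then show ?thesis by (simp add: co_cls cograph_cls fgraph_compl P4_free_compl)
qed

lemma cograph_0 [simp]: "cograph 0"
  using cograph_cls[of "{}" "\<lambda>_ _. False"] by (simp add: zero_gclass_def fgraph_def P4_free_def)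

lemma cograph_sum_mset: "cograph (sum_mset M) \<longleftrightarrow> (\<forall>s\<in>#M. cograph s)"
  by (induction M) auto

section \<open>Connectedness of a cograph and of its complement\<close>

lemma connected_cls:
  assumes "fgraph V E"
  shows "gconnected (cls V E) \<longleftrightarrow> V \<noteq> {} \<and> (\<forall>X Y. gsplit V E X Y \<longrightarrow> X = {} \<or> Y = {})"
proof
  assume "gconnected (cls V E)"
  then show "V \<noteq> {} \<and> (\<forall>X Y. gsplit V E X Y \<longrightarrow> X = {} \<or> Y = {})"
    using connected_gsplit cls_eq_0[OF assms] unfolding gconnected_def by blast
next
  assume r: "V \<noteq> {} \<and> (\<forall>X Y. gsplit V E X Y \<longrightarrow> X = {} \<or> Y = {})"
  show "gconnected (cls V E)"
    unfolding gconnected_def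
  proof (intro conjI allI impI)
    show "cls V E \<noteq> 0" using r cls_eq_0[OF assms] by blast
    fix a b assume "cls V E = a + b"
    then obtain X Y where s: "gsplit V E X Y" "cls X E = a" "cls Y E = b"
      using gsplit_plusE assms by blast
    then show "a = 0 \<or> b = 0"
      using r cls_eq_0[OF gsplitD(2)[OF s(1)]] cls_eq_0[OF gsplitD(3)[OF s(1)]] by blast
  qed
qed

text \<open>All possible edges run between \<open>X'\<close> and \<open>Y'\<close> and none between
  \<open>X\<close> and \<open>Y\<close>, so \<open>X\<close> cannot meet \<open>X'\<close> while
  \<open>Y\<close> meets \<open>Y'\<close>, and likewise crosswise.\<close>

lemma connected_co_if_split:
  assumes "gsplit V E X Y" "X \<noteq> {}" "Y \<noteq> {}" "gsplit V (compl_rel E) X' Y'"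
  shows "X' = {} \<or> Y' = {}"
proof (rule ccontr)
  assume n: "\<not> (X' = {} \<or> Y' = {})"
  note d = gsplitD[OF assms(1)] and d' = gsplitD[OF assms(4)]
  have E: "E i j" if "i \<in> X'" "j \<in> Y'" for i j
    using d'(5,6) that unfolding compl_rel_def by blast
  have E': "E i j" if "i \<in> Y'" "j \<in> X'" for i j
    using d'(5,7) that unfolding compl_rel_def by blast
  have "X \<inter> X' = {} \<or> Y \<inter> Y' = {}" "X \<inter> Y' = {} \<or> Y \<inter> X' = {}"
    using E E' d(6) by blast+
  then show False using n assms(2,3) d(4) d'(4) d(5) d'(5) by blast
qed

text \<open>Without neighbours in \<open>Y\<close>, the vertex \<open>v\<close> joins
  \<open>X\<close>. With a neighbour \<open>z\<close> in \<open>Y\<close>, the non-neighbours of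
  \<open>v\<close> in \<open>X\<close> are separated from everything else: an edge from such an
  \<open>a\<close> to a neighbour \<open>w\<close> of \<open>v\<close> in \<open>X\<close> would
  give the induced path \<open>a\<close>, \<open>w\<close>, \<open>v\<close>,
  \<open>z\<close>.\<close>

lemma P4_free_extend_aux:
  assumes V: "fgraph V E" "P4_free V E" "v \<in> V" and s: "gsplit (V - {v}) E X Y"
    and Y: "Y \<noteq> {}" and u: "u \<in> X" "\<not> E v u"
  shows "\<exists>X Y. gsplit V E X Y \<and> X \<noteq> {} \<and> Y \<noteq> {}"
proof (cases "\<forall>z\<in>Y. \<not> E v z")
  case True
  note d = gsplitD[OF s]
  have "V = insert v X \<union> Y" "insert v X \<inter> Y = {}" using d(4,5) V(3) by blast+
  moreover have "\<forall>i\<in>insert v X. \<forall>j\<in>Y. \<not> E i j" using True d(6) by simp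
  ultimately have "gsplit V E (insert v X) Y" using V(1) unfolding gsplit_def by blast
  then show ?thesis using Y by blast
next
  case False
  note d = gsplitD[OF s]
  have sym: "E i j = E j i" if "i \<in> V" "j \<in> V" for i j
    using V(1) that unfolding fgraph_def by blast
  from False obtain z where z: "z \<in> Y" "E v z" by blast
  let ?A = "{x \<in> X. \<not> E v x}"
  have sub: "X \<subseteq> V" "Y \<subseteq> V" "v \<notin> X" "v \<notin> Y" using d(4) by blast+
  have X: "\<not> E a w" if a: "a \<in> ?A" and w: "w \<in> X - ?A" for a w
  proof
    assume aw: "E a w"
    have "P4_at E a w v z"
      unfolding P4_at_def
    proof (intro conjI)
      have m: "a \<in> X" "w \<in> X" "a \<in> V" "w \<in> V" "\<not> E v a" "E v w" "z \<in> V"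
        using a w z(1) sub(1,2) by blast+
      have "a \<noteq> w" "a \<noteq> v" "w \<noteq> v" "z \<noteq> v" "a \<noteq> z" "w \<noteq> z" using m z(1) sub(3,4) d(5) by blast+
      then show "distinct [a, w, v, z]" by simp
      show "E w v" "\<not> E a v" using m V(3) sym by blast+
      show "\<not> E w z" "\<not> E a z" using m z(1) d(6) by blast+
    qed (fact aw z)+
    moreover have "a \<in> V" "w \<in> V" "z \<in> V" using a w z(1) sub(1,2) by blast+
    ultimately show False using V(2,3) unfolding P4_free_def by blast
  qed
  have "\<not> E a w" if a: "a \<in> ?A" and w: "w \<in> V - ?A" for a w
  proof -
    have aV: "a \<in> V" "a \<in> X" "\<not> E v a" using a sub(1) by blast+
    consider "w = v" | "w \<in> X - ?A" | "w \<in> Y" using w d(4) by blast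
    then show ?thesis
    proof cases
      case 1 then show ?thesis using aV sym V(3) by blast
    next
      case 2 then show ?thesis using a X by blast
    next
      case 3 then show ?thesis using aV d(6) by blast
    qed
  qed
  moreover have "V = ?A \<union> (V - ?A)" using sub(1) by blast
  ultimately have "gsplit V E ?A (V - ?A)" unfolding gsplit_def using V(1) by blast
  moreover have "u \<in> ?A" "v \<in> V - ?A" using u V(3) sub by blast+
  ultimately show ?thesis by blast
qed

text \<open>Either some other vertex is not adjacent to \<open>v\<close>, and
  \<open>P4_free_extend_aux\<close> splits the graph, or \<open>v\<close> is isolated in the
  complement.\<close>

lemma P4_free_extend:
  assumes V: "fgraph V E" "P4_free V E" "v \<in> V" and s: "gsplit (V - {v}) E X Y"
    and ne: "X \<noteq> {}" "Y \<noteq> {}"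
  shows "(\<exists>X Y. gsplit V E X Y \<and> X \<noteq> {} \<and> Y \<noteq> {}) \<or>
    (\<exists>X Y. gsplit V (compl_rel E) X Y \<and> X \<noteq> {} \<and> Y \<noteq> {})"
proof (cases "\<exists>u\<in>V - {v}. \<not> E v u")
  case True
  then obtain u where u: "u \<in> X \<or> u \<in> Y" "\<not> E v u" using gsplitD(4)[OF s] by blast
  then show ?thesis
    using P4_free_extend_aux[OF V s ne(2)] P4_free_extend_aux[OF V gsplit_sym[OF s] ne(1)] by blast
next
  case False
  have "gsplit V (compl_rel E) {v} (V - {v})"
    using False V(3) fgraph_compl[OF V(1)] unfolding gsplit_def compl_rel_def by blast
  moreover have "V - {v} \<noteq> {}" using ne gsplitD(4)[OF s] by blast
  ultimately show ?thesis by blast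
qed

lemma gsplit_compl_compl:
  assumes "fgraph V E" "gsplit V (compl_rel (compl_rel E)) X Y"
  shows "gsplit V E X Y"
proof -
  note d = gsplitD[OF assms(2)]
  have "\<not> E i j" if "i \<in> X" "j \<in> Y" for i j
    using d(6)[OF that] compl_compl[OF assms(1)] that d(4) by blast
  then show ?thesis using d(4,5) assms(1) unfolding gsplit_def by blast
qed

text \<open>Seinsche's theorem, by deleting a vertex and splitting the rest or its complement; two
  vertices are the base case.\<close>

lemma P4_free_split:
  assumes "fgraph V E" "P4_free V E" "card V \<ge> 2"
  shows "(\<exists>X Y. gsplit V E X Y \<and> X \<noteq> {} \<and> Y \<noteq> {}) \<or>
    (\<exists>X Y. gsplit V (compl_rel E) X Y \<and> X \<noteq> {} \<and> Y \<noteq> {})"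
  using assms
proof (induction "card V" arbitrary: V rule: less_induct)
  case less
  have fin: "finite V" using less.prems(1) by (simp add: fgraph_def)
  obtain v where v: "v \<in> V" using less.prems(3) by fastforce
  let ?U = "V - {v}"
  have U: "card ?U = card V - 1" using v fin by simp
  have fU: "fgraph ?U E" using less.prems(1) by (rule fgraph_subset) blast
  show ?case
  proof (cases "card V = 2")
    case True
    then have "card ?U = 1" using U by simp
    then obtain u where u: "?U = {u}" by (rule card_1_singletonE)
    then have V: "V = {v} \<union> {u}" "{v} \<inter> {u} = {}" using v by blast+
    show ?thesis
    proof (cases "E v u")
      case True
      then have "gsplit V (compl_rel E) {v} {u}"
        using V fgraph_compl[OF less.prems(1)] unfolding gsplit_def compl_rel_def by blast
      then show ?thesis by blast
    next
      case False
      then have "gsplit V E {v} {u}" using V less.prems(1) unfolding gsplit_def by blast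
      then show ?thesis by blast
    qed
  next
    case False
    then have "card ?U < card V" "card ?U \<ge> 2" using U less.prems(3) by linarith+
    moreover have "P4_free ?U E" using less.prems(2) by (rule P4_free_subset) blast
    ultimately have IH: "(\<exists>X Y. gsplit ?U E X Y \<and> X \<noteq> {} \<and> Y \<noteq> {}) \<or>
      (\<exists>X Y. gsplit ?U (compl_rel E) X Y \<and> X \<noteq> {} \<and> Y \<noteq> {})"
      using less.hyps fU by blast
    \<comment> \<open>A split of the complement of the rest is extended in the complement, which is
      \<open>P4_free\<close> as well; double complements are undone afterwards.\<close>
    have "P4_free V (compl_rel E)" using less.prems P4_free_compl by blast
    then show ?thesis
      using IH P4_free_extend[OF less.prems(1,2) v]
        P4_free_extend[OF fgraph_compl[OF less.prems(1)] _ v] gsplit_compl_compl[OF less.prems(1)]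
      by meson
  qed
qed

text \<open>\<open>P4_free_split\<close> excludes that both are connected,
  \<open>connected_co_if_split\<close> that neither is.\<close>

lemma connected_co_iff:
  assumes "cograph c" "gsize c \<ge> 2"
  shows "gconnected (co c) \<longleftrightarrow> \<not> gconnected c"
proof -
  obtain V E where VE: "fgraph V E" "c = cls V E" by (rule gclass_exhaust)
  then have P: "P4_free V E" "card V \<ge> 2" using assms by (simp_all add: cograph_cls gsize_cls)
  then have "V \<noteq> {}" by auto
  then show ?thesis
    using P4_free_split[OF VE(1) P] connected_co_if_split
    unfolding VE(2) co_cls[OF VE(1)] connected_cls[OF VE(1)] connected_cls[OF fgraph_compl[OF VE(1)]]
    by meson
qed

lemma connected_if_gsize_1: "gsize c = 1 \<Longrightarrow> gconnected c"
  unfolding gconnected_def by (auto simp: add_is_1 simp flip: gsize_eq_0_iff)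

definition K1 :: gclass where "K1 = cls {0} (\<lambda>_ _. False)"

lemma gsize_K1 [simp]: "gsize K1 = 1"
  unfolding K1_def by (subst gsize_cls) (auto simp: fgraph_def)

lemma connected_K1: "gconnected K1"
  by (simp add: connected_if_gsize_1)

lemma cograph_K1: "cograph K1"
  unfolding K1_def by (subst cograph_cls) (auto simp: fgraph_def P4_free_def P4_at_def)

lemma gsize_1_iff: "gsize c = 1 \<longleftrightarrow> c = K1"
proof
  assume c: "gsize c = 1"
  obtain V E where VE: "fgraph V E" "c = cls V E" by (rule gclass_exhaust)
  then obtain v where v: "V = {v}" using c by (auto simp: gsize_cls card_1_singleton_iff)
  have "iso_via (\<lambda>_. 0) V E {0} (\<lambda>_ _. False)"
    using VE(1) by (auto simp: v iso_via_def bij_betw_def fgraph_def)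
  then show "c = K1" unfolding VE(2) K1_def using cls_eq_iff[OF VE(1)] by (auto simp: fgraph_def)
qed simp

text \<open>Every class of size \<open>n\<close> has a representative on \<open>{..<n}\<close>,
  whose edges form one of finitely many sets of pairs.\<close>

lemma finite_gsize: "finite {c. gsize c = n}"
proof -
  have "{c. gsize c = n} \<subseteq> (\<lambda>A. cls {..<n} (\<lambda>i j. (i, j) \<in> A)) ` Pow ({..<n} \<times> {..<n})"
  proof
    fix c assume "c \<in> {c. gsize c = n}"
    moreover obtain V E where VE: "fgraph V E" "c = cls V E" by (rule gclass_exhaust)
    ultimately have "card V = n" "finite V" by (auto simp: gsize_cls fgraph_def)
    then obtain f where f: "bij_betw f {..<n} V" using ex_bij_betw_nat_finite lessThan_atLeast0 by metis
    define A where "A = {(i, j). i < n \<and> j < n \<and> E (f i) (f j)}"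
    have iso: "iso_via f {..<n} (\<lambda>i j. (i, j) \<in> A) V E" using f by (simp add: iso_via_def A_def)
    then have "fgraph {..<n} (\<lambda>i j. (i, j) \<in> A)"
      using iso_via_fgraph[OF iso_via_inv[OF iso] VE(1)] by simp
    then have "cls {..<n} (\<lambda>i j. (i, j) \<in> A) = cls V E" using cls_eq_iff[OF _ VE(1)] iso by blast
    moreover have "A \<in> Pow ({..<n} \<times> {..<n})" by (auto simp: A_def)
    ultimately show "c \<in> (\<lambda>A. cls {..<n} (\<lambda>i j. (i, j) \<in> A)) ` Pow ({..<n} \<times> {..<n})"
      unfolding VE(2) by (metis image_eqI)
  qed
  then show ?thesis by (rule finite_subset) simp
qed

section \<open>Switching\<close>

text \<open>The Godsil--McKay condition with a single cell \<open>C\<close> to be switched. Writing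
  its size as \<open>2 * k\<close> makes half of it a natural number.\<close>

definition switching_set ::
    "nat set \<Rightarrow> (nat \<Rightarrow> nat \<Rightarrow> bool) \<Rightarrow> nat set \<Rightarrow> nat \<Rightarrow> bool" where
  "switching_set V E C k \<longleftrightarrow> C \<subseteq> V \<and> card C = 2 * k \<and> 0 < k \<and>
     (\<exists>r. \<forall>i\<in>C. card {j \<in> C. E i j} = r) \<and>
     (\<forall>i\<in>V - C. card {j \<in> C. E i j} \<in> {0, k, 2 * k})"

text \<open>The inequality of truth values acts as exclusive or: it toggles the pairs between
  \<open>C\<close> and the outside vertices that see half of \<open>C\<close>.\<close>

definition switch :: "nat set \<Rightarrow> nat \<Rightarrow> (nat \<Rightarrow> nat \<Rightarrow> bool) \<Rightarrow> nat \<Rightarrow> nat \<Rightarrow> bool" where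
  "switch C k E i j \<longleftrightarrow> E i j \<noteq> (i \<in> C \<and> j \<notin> C \<and> card {l \<in> C. E j l} = k \<or>
     i \<notin> C \<and> j \<in> C \<and> card {l \<in> C. E i l} = k)"

lemma fgraph_switch: "fgraph V E \<Longrightarrow> fgraph V (switch C k E)"
  unfolding fgraph_def switch_def by blast

text \<open>Leaving the class of cographs is a local certificate of non-isomorphism: an induced path
  created by the switching survives in larger graphs.\<close>

definition mated_graph :: "nat set \<Rightarrow> (nat \<Rightarrow> nat \<Rightarrow> bool) \<Rightarrow> bool" where
  "mated_graph V E \<longleftrightarrow> (\<exists>C k. switching_set V E C k \<and> \<not> P4_free V (switch C k E))"

lemma mated_graph_iso:
  assumes iso: "iso_via f V E W F" and "mated_graph V E"
  shows "mated_graph W F"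
proof -
  from assms(2) obtain C k where
    C: "C \<subseteq> V" "card C = 2 * k" "0 < k" "\<forall>i\<in>V - C. card {j \<in> C. E i j} \<in> {0, k, 2 * k}"
    and P: "\<not> P4_free V (switch C k E)" and reg: "\<exists>r. \<forall>i\<in>C. card {j \<in> C. E i j} = r"
    unfolding mated_graph_def switching_set_def by blast
  from reg obtain r where r: "\<forall>i\<in>C. card {j \<in> C. E i j} = r" by blast
  have E: "E i j \<longleftrightarrow> F (f i) (f j)" if "i \<in> V" "j \<in> V" for i j
    using iso that by (simp add: iso_via_def)
  have inj: "inj_on f V" and W: "W = f ` V" using iso by (simp_all add: iso_via_def bij_betw_def)
  have mem: "f i \<in> f ` C \<longleftrightarrow> i \<in> C" if "i \<in> V" for i
    using inj_on_image_mem_iff[OF inj that C(1)] .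
  have card: "card {j \<in> f ` C. F (f i) j} = card {j \<in> C. E i j}" if "i \<in> V" for i
  proof -
    have "{j \<in> f ` C. F (f i) j} = f ` {j \<in> C. E i j}" using E that C(1) by blast
    moreover have "inj_on f {j \<in> C. E i j}" using inj by (rule inj_on_subset) (use C(1) in blast)
    ultimately show ?thesis by (simp add: card_image)
  qed
  have "inj_on f C" using inj C(1) by (rule inj_on_subset)
  then have "card (f ` C) = 2 * k" using C(2) by (simp add: card_image)
  moreover have "f ` C \<subseteq> W" using W C(1) by blast
  moreover have "\<forall>i\<in>f ` C. card {j \<in> f ` C. F i j} = r" using r card C(1) by (simp add: subset_iff)
  moreover have "\<forall>i\<in>W - f ` C. card {j \<in> f ` C. F i j} \<in> {0, k, 2 * k}"
  proof
    fix i assume "i \<in> W - f ` C"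
    then obtain i' where i': "i' \<in> V - C" "i = f i'" using W by blast
    then show "card {j \<in> f ` C. F i j} \<in> {0, k, 2 * k}" using C(4) card by simp
  qed
  ultimately have "switching_set W F (f ` C) k" unfolding switching_set_def using C(3) by blast
  moreover have "iso_via f V (switch C k E) W (switch (f ` C) k F)"
    using iso E mem card unfolding iso_via_def switch_def by simp
  then have "\<not> P4_free W (switch (f ` C) k F)" using P P4_free_iso by blast
  ultimately show ?thesis unfolding mated_graph_def by blast
qed

definition mated :: "gclass \<Rightarrow> bool" where
  "mated c \<longleftrightarrow> (\<exists>V E. fgraph V E \<and> c = cls V E \<and> mated_graph V E)"

lemma mated_cls:
  assumes "fgraph V E"
  shows "mated (cls V E) \<longleftrightarrow> mated_graph V E"
proof
  assume "mated (cls V E)"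
  then obtain W F where W: "fgraph W F" "cls W F = cls V E" "mated_graph W F"
    unfolding mated_def by metis
  then obtain f where "iso_via f W F V E" using cls_eq_iff[OF W(1) assms] by blast
  then show "mated_graph V E" using W(3) by (rule mated_graph_iso)
next
  assume "mated_graph V E"
  then show "mated (cls V E)" using assms unfolding mated_def by blast
qed

text \<open>Vertices of the other summand have no neighbour in \<open>C\<close>, so the switching
  set stays admissible and the induced path it creates remains.\<close>

lemma mated_plus:
  assumes "mated a"
  shows "mated (a + b)"
proof -
  obtain V E X Y where s: "gsplit V E X Y" "cls X E = a" "cls Y E = b" by (rule gsplit_ex)
  note d = gsplitD[OF s(1)]
  have "mated_graph X E" using assms mated_cls[OF d(2)] s(2) by blast
  then obtain C k where C: "switching_set X E C k" "\<not> P4_free X (switch C k E)"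
    unfolding mated_graph_def by blast
  have CX: "C \<subseteq> X" using C(1) unfolding switching_set_def by blast
  have "card {j \<in> C. E i j} = 0" if "i \<in> Y" for i
  proof -
    have "{j \<in> C. E i j} = {}" using d(7) CX that by blast
    then show ?thesis by (simp only: card.empty)
  qed
  then have "\<forall>i\<in>V - C. card {j \<in> C. E i j} \<in> {0, k, 2 * k}"
    using C(1) d(4) unfolding switching_set_def by blast
  then have "switching_set V E C k" using C(1) d(4) unfolding switching_set_def by blast
  moreover have "\<not> P4_free V (switch C k E)" using C(2) P4_free_subset d(4) by blast
  ultimately have "mated_graph V E" unfolding mated_graph_def by blast
  then show ?thesis using mated_cls[OF d(1)] cls_gsplit[OF s(1)] s(2,3) by simp
qed

text \<open>Complementation turns the inner degree \<open>r\<close> into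
  \<open>2 * k - (r + 1)\<close> and, outside, swaps 0 with \<open>2 * k\<close> and keeps
  \<open>k\<close>. The same outside vertices are therefore switched.\<close>

lemma switching_set_compl:
  assumes V: "fgraph V E" and C: "switching_set V E C k"
  shows "switching_set V (compl_rel E) C k"
    and "\<And>i j. i \<in> V \<Longrightarrow> j \<in> V \<Longrightarrow> switch C k (compl_rel E) i j \<longleftrightarrow> compl_rel (switch C k E) i j"
proof -
  have CV: "C \<subseteq> V" "card C = 2 * k" "k > 0"
    and deg: "\<And>i. i \<in> V - C \<Longrightarrow> card {j \<in> C. E i j} \<in> {0, k, 2 * k}"
  proof -
    have "\<forall>i\<in>V - C. card {j \<in> C. E i j} \<in> {0, k, 2 * k}"
      using C unfolding switching_set_def by iprover
    then show "i \<in> V - C \<Longrightarrow> card {j \<in> C. E i j} \<in> {0, k, 2 * k}" for i by (rule bspec)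
  qed (use C in \<open>simp_all add: switching_set_def\<close>)
  obtain r where r: "\<And>i. i \<in> C \<Longrightarrow> card {j \<in> C. E i j} = r"
    using C unfolding switching_set_def by blast
  have fin: "finite C" by (rule card_ge_0_finite) (simp add: CV)
  have inside: "card {j \<in> C. compl_rel E i j} = 2 * k - (r + 1)" if "i \<in> C" for i
  proof -
    have "\<not> E i i" using V that CV(1) unfolding fgraph_def by blast
    then have "{j \<in> C. compl_rel E i j} = C - insert i {j \<in> C. E i j}"
      unfolding compl_rel_def by blast
    moreover have "card (insert i {j \<in> C. E i j}) = r + 1"
      using fin r[OF that] \<open>\<not> E i i\<close> by simp
    ultimately show ?thesis using fin that CV(2) card_Diff_subset[of "insert i {j \<in> C. E i j}" C]
      by simp
  qed
  have outside: "card {j \<in> C. compl_rel E i j} = 2 * k - card {j \<in> C. E i j}"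
    and le: "card {j \<in> C. E i j} \<le> 2 * k" if "i \<notin> C" for i
  proof -
    have "{j \<in> C. compl_rel E i j} = C - {j \<in> C. E i j}"
      using that unfolding compl_rel_def by blast
    then show "card {j \<in> C. compl_rel E i j} = 2 * k - card {j \<in> C. E i j}"
      using fin CV(2) card_Diff_subset[of "{j \<in> C. E i j}" C] by simp
    show "card {j \<in> C. E i j} \<le> 2 * k" unfolding CV(2)[symmetric] using fin by (intro card_mono) auto
  qed
  have "card {j \<in> C. compl_rel E i j} \<in> {0, k, 2 * k}" if "i \<in> V - C" for i
    using deg[OF that] outside[of i] that by auto
  then show "switching_set V (compl_rel E) C k"
    unfolding switching_set_def using CV inside by blast
  have eq: "card {j \<in> C. compl_rel E i j} = k \<longleftrightarrow> card {j \<in> C. E i j} = k" if "i \<notin> C" for i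
    using outside[OF that] le[OF that] by linarith
  show "switch C k (compl_rel E) i j \<longleftrightarrow> compl_rel (switch C k E) i j"
    if ij: "i \<in> V" "j \<in> V" for i j
  proof (cases "i = j")
    case True
    then show ?thesis by (simp add: switch_def compl_rel_def)
  next
    case False
    then have "compl_rel E i j \<longleftrightarrow> \<not> E i j" by (simp add: compl_rel_def)
    then show ?thesis using False eq unfolding switch_def compl_rel_def[of "switch C k E"] by metis
  qed
qed

lemma mated_co:
  assumes "mated c"
  shows "mated (co c)"
proof -
  obtain V E where VE: "fgraph V E" "c = cls V E" by (rule gclass_exhaust)
  then obtain C k where C: "switching_set V E C k" "\<not> P4_free V (switch C k E)"
    using assms mated_cls unfolding mated_graph_def by blast
  have "\<not> P4_free V (compl_rel (switch C k E))"
    using C(2) P4_free_compl[OF fgraph_switch[OF VE(1)]] by blast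
  then have "\<not> P4_free V (switch C k (compl_rel E))"
    using P4_free_cong[of V "switch C k (compl_rel E)" "compl_rel (switch C k E)"]
      switching_set_compl(2)[OF VE(1) C(1)] by blast
  then have "mated_graph V (compl_rel E)"
    using switching_set_compl(1)[OF VE(1) C(1)] unfolding mated_graph_def by blast
  then show ?thesis using VE mated_cls fgraph_compl co_cls by simp
qed

text \<open>The vertices 1, 2, 3 and 4, 5, 6 are the sides of a complete bipartite graph, 7 to 10 form a
  complete graph, and 0 is adjacent to five of the six bipartite vertices. The vertices 1 to 10 induce
  a 3-regular graph and form the switching set, which makes 4, 1, 0, 7 a path.\<close>

definition ex_edge :: "nat \<Rightarrow> nat \<Rightarrow> bool" where
  "ex_edge i j \<longleftrightarrow> i \<noteq> j \<and> (i \<ge> 7 \<and> j \<ge> 7 \<or>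
     i \<in> {1, 2, 3} \<and> j \<in> {4, 5, 6} \<or> j \<in> {1, 2, 3} \<and> i \<in> {4, 5, 6} \<or>
     i = 0 \<and> j \<in> {2, 3, 4, 5, 6} \<or> j = 0 \<and> i \<in> {2, 3, 4, 5, 6})"

lemma fgraph_ex: "fgraph {0..10} ex_edge"
  unfolding fgraph_def ex_edge_def by auto

text \<open>The complete part contains no induced path, and no edge leaves it. Among 0 to 6,
  distinct non-adjacent vertices lie on the same side of \<open>{0,1,2,3}\<close> and
  \<open>{4,5,6}\<close>, so the non-edges put all four path vertices on one side. Edges within a
  side contain 0, but \<open>a b\<close> and \<open>c d\<close> are disjoint.\<close>

lemma P4_free_ex: "P4_free {0..10} ex_edge"
  unfolding P4_free_def
proof (intro ballI notI)
  fix a b c d :: nat assume P: "P4_at ex_edge a b c d"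
  have e: "ex_edge a b" "ex_edge b c" "ex_edge c d" "\<not> ex_edge a c" "\<not> ex_edge b d" "\<not> ex_edge a d"
    "a \<noteq> b" "a \<noteq> c" "a \<noteq> d" "b \<noteq> c" "b \<noteq> d" "c \<noteq> d"
    using P by (auto simp: P4_at_def)
  have big: "j \<ge> 7 \<longleftrightarrow> i \<ge> 7" if "ex_edge i j" for i j
    using that unfolding ex_edge_def by auto
  have small: "a < 7" "b < 7" "c < 7" "d < 7"
  proof -
    have "\<not> a \<ge> 7" using e(1,2,4,8) big[OF e(1)] big[OF e(2)] unfolding ex_edge_def by blast
    then show "a < 7" "b < 7" "c < 7" "d < 7"
      using big[OF e(1)] big[OF e(2)] big[OF e(3)] by linarith+
  qed
  define S where "S = {4, 5, 6 :: nat}"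
  have side: "j \<in> S \<longleftrightarrow> i \<in> S" if ij: "i < 7" "j < 7" "i \<noteq> j" "\<not> ex_edge i j" for i j
  proof -
    have mem: "l \<in> {0,1,2,3} \<or> l \<in> {4,5,6}" if "l < 7" for l :: nat
      using that by auto
    have "ex_edge k l" "ex_edge l k" if "k \<in> {0,1,2,3}" "l \<in> {4,5,6}" for k l
      using that by (auto simp: ex_edge_def)
    then have "\<not> (i \<in> {0,1,2,3} \<and> j \<in> {4,5,6})" "\<not> (j \<in> {0,1,2,3} \<and> i \<in> {4,5,6})"
      using ij(4) by metis+
    then show ?thesis using mem[OF ij(1)] mem[OF ij(2)] unfolding S_def by argo
  qed
  have in_side: "i = 0 \<or> j = 0" if "ex_edge i j" "i < 7" "i \<in> S \<longleftrightarrow> j \<in> S" for i j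
    using that unfolding ex_edge_def S_def by auto
  have "c \<in> S \<longleftrightarrow> a \<in> S" "d \<in> S \<longleftrightarrow> b \<in> S" "d \<in> S \<longleftrightarrow> a \<in> S"
    using side small e by blast+
  then have "a = 0 \<or> b = 0" "b = 0 \<or> c = 0" "c = 0 \<or> d = 0"
    using in_side[OF e(1) small(1)] in_side[OF e(2) small(2)] in_side[OF e(3) small(3)] by blast+
  then show False using e(7-12) by metis
qed

lemma mated_ex: "mated_graph {0..10} ex_edge"
proof -
  let ?C = "{1,2,3,4,5,6,7,8,9,10} :: nat set"
  have count: "card {j \<in> ?C. P j} = (\<Sum>j\<in>?C. if P j then 1 else 0)" for P
    unfolding card_eq_sum by (rule sum.inter_filter) simp
  have deg: "card {j \<in> ?C. ex_edge i j} = 3" if "i \<in> ?C" for i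
    using that unfolding count by (elim insertE emptyE) (simp_all add: ex_edge_def)
  have deg0: "card {j \<in> ?C. ex_edge 0 j} = 5" unfolding count by (simp add: ex_edge_def)
  have "switching_set {0..10} ex_edge ?C 5"
    unfolding switching_set_def
  proof (intro conjI)
    have "{0..10} - ?C = {0}" by (auto, arith)
    then show "\<forall>i\<in>{0..10} - ?C. card {j \<in> ?C. ex_edge i j} \<in> {0, 5, 2 * 5}" using deg0 by simp
  qed (use deg in auto)
  moreover have "P4_at (switch ?C 5 ex_edge) 4 1 0 7"
    unfolding P4_at_def switch_def deg0 by (simp add: ex_edge_def)
  then have "\<not> P4_free {0..10} (switch ?C 5 ex_edge)"
    unfolding P4_free_def by force
  ultimately show ?thesis unfolding mated_graph_def by blast
qed

lemma ex_mated_cograph: "\<exists>c. cograph c \<and> mated c"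
  using P4_free_ex mated_ex fgraph_ex cograph_cls mated_cls by blast

section \<open>Spectra\<close>

lemma adj_matrix_carrier [simp]: "adj_matrix n G \<in> carrier_mat n n"
  by (simp add: adj_matrix_def)

lemma adj_matrix_cong:
  "(\<And>i j. i < n \<Longrightarrow> j < n \<Longrightarrow> G i j = H i j) \<Longrightarrow> adj_matrix n G = adj_matrix n H"
  unfolding adj_matrix_def by (rule eq_matI) auto

text \<open>Let \<open>Q\<close> be \<open>J / k - I\<close> on \<open>C\<close>, with
  \<open>J\<close> the all-ones matrix, and the identity elsewhere. It is an involution because
  \<open>C\<close> has \<open>2 * k\<close> elements, and conjugation by it carries out the
  switching.\<close>

lemma switch_similar:
  assumes V: "fgraph {0..<n} E" and C: "switching_set {0..<n} E C k"
  shows "similar_mat (adj_matrix n (switch C k E)) (adj_matrix n E)"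
proof -
  let ?B = "adj_matrix n (switch C k E)" and ?A = "adj_matrix n E"
  define deg where "deg i = card {l \<in> C. E i l}" for i
  have CV: "C \<subseteq> {0..<n}" "card C = 2 * k" "k > 0"
    using C by (simp_all add: switching_set_def)
  have fin: "finite C" using CV(1) by (rule finite_subset) simp
  have out: "deg i \<in> {0, k, 2 * k}" if "i < n" "i \<notin> C" for i
  proof -
    have "\<forall>i\<in>{0..<n} - C. card {l \<in> C. E i l} \<in> {0, k, 2 * k}"
      using C unfolding switching_set_def by iprover
    then show ?thesis using that unfolding deg_def by simp
  qed
  obtain r where r: "\<And>i. i \<in> C \<Longrightarrow> deg i = r"
    using C unfolding switching_set_def deg_def by blast
  have sym: "E i j = E j i" if "i < n" "j < n" for i j
    using V that unfolding fgraph_def by (metis atLeastLessThan_iff zero_le)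
  define a b q :: "nat \<Rightarrow> nat \<Rightarrow> complex"
    where "a i j = of_bool (E i j)" and "b i j = of_bool (switch C k E i j)"
      and "q i j = (if i \<in> C \<and> j \<in> C then 1 / of_nat k else 0) +
         (if i = j then if i \<in> C then - 1 else 1 else 0)" for i j
  define Q where "Q = Matrix.mat n n (\<lambda>(i, j). q i j)"
  have Qc: "Q \<in> carrier_mat n n" by (simp add: Q_def)
  have k0: "(of_nat k :: complex) \<noteq> 0" using CV(3) by simp
  \<comment> \<open>On \<open>C\<close>, applying \<open>Q\<close> reflects a vector in its mean:
    the sum over \<open>2 * k\<close> entries divided by \<open>k\<close> is twice the mean.\<close>
  have qx: "(\<Sum>l<n. q i l * x l) = (if i \<in> C then (\<Sum>l\<in>C. x l) / of_nat k - x i else x i)"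
    if "i < n" for i and x :: "nat \<Rightarrow> complex"
  proof -
    have "(\<Sum>l<n. q i l * x l) =
      (\<Sum>l<n. (if l \<in> C then if i \<in> C then x l / of_nat k else 0 else 0)) +
      (\<Sum>l<n. if i = l then (if i \<in> C then - x i else x i) else 0)"
      unfolding sum.distrib[symmetric] q_def by (rule sum.cong) (auto simp: distrib_right)
    also have "(\<Sum>l<n. (if l \<in> C then if i \<in> C then x l / of_nat k else 0 else 0)) =
        (\<Sum>l\<in>C. if i \<in> C then x l / of_nat k else 0)"
      using CV(1) by (subst sum.inter_restrict[symmetric]) (auto simp: Int_absorb1 intro!: sum.cong)
    finally show ?thesis using that by (simp add: sum_divide_distrib)
  qed
  have qsym: "q i j = q j i" for i j by (auto simp: q_def)
  have suma: "(\<Sum>l\<in>C. a i l) = of_nat (deg i)" for i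
    using fin unfolding a_def deg_def by (simp add: Int_def)
  have bC: "b i j = a i j" if "i \<in> C \<longleftrightarrow> j \<in> C" for i j
    using that by (simp add: a_def b_def switch_def)
  \<comment> \<open>One formula covers the three admissible degrees: the quotient is 0 with
    \<open>a i j = 0\<close>, or 1, or 2 with \<open>a i j = 1\<close>.\<close>
  have bout: "b i j = of_nat (deg j) / of_nat k - a i j" "b j i = b i j" "a j i = a i j"
    if ij: "i \<in> C" "j \<notin> C" "j < n" for i j
  proof -
    have "i < n" using ij(1) CV(1) by auto
    then have E: "E j i = E i j" using sym ij(3) by blast
    then show "a j i = a i j" "b j i = b i j"
      using ij by (simp_all add: a_def b_def switch_def)
    consider "deg j = 0" | "deg j = k" | "deg j = 2 * k" using out[OF ij(3,2)] by auto
    then show "b i j = of_nat (deg j) / of_nat k - a i j"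
    proof cases
      case 1
      then have "\<not> E j i" using fin ij(1) by (auto simp: deg_def)
      then show ?thesis using 1 ij E CV(3) by (simp add: a_def b_def switch_def deg_def)
    next
      case 2
      then show ?thesis using ij k0 by (simp add: a_def b_def switch_def deg_def)
    next
      case 3
      then have "{l \<in> C. E j l} = C" using fin CV(2) by (intro card_subset_eq) (auto simp: deg_def)
      then have "E j i" using ij(1) by blast
      then show ?thesis using 3 ij E k0 CV(3) by (simp add: a_def b_def switch_def deg_def)
    qed
  qed
  \<comment> \<open>Inside \<open>C\<close> nothing changes, and a toggled vertex sees half of
    \<open>C\<close> before and after.\<close>
  have sumb: "(\<Sum>l\<in>C. b i l) = of_nat (deg i)" if "i < n" for i
  proof (cases "i \<in> C")
    case True
    then have "(\<Sum>l\<in>C. b i l) = (\<Sum>l\<in>C. a i l)" by (intro sum.cong bC) auto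
    then show ?thesis using suma by simp
  next
    case False
    have "(\<Sum>l\<in>C. b i l) = (\<Sum>l\<in>C. of_nat (deg i) / of_nat k - a i l)"
      using bout[OF _ False that] by (intro sum.cong) auto
    also have "\<dots> = 2 * of_nat (deg i) - of_nat (deg i)"
      using k0 by (simp add: sum_subtractf suma CV(2))
    finally show ?thesis by simp
  qed
  have sumq: "(\<Sum>l\<in>C. q l j) = (if j \<in> C then 1 else 0)" for j
  proof -
    have "(\<Sum>l\<in>C. q l j) = (\<Sum>l\<in>C. if j \<in> C then 1 / of_nat k else 0) + (\<Sum>l\<in>C. if l = j then - 1 else 0)"
      unfolding sum.distrib[symmetric] q_def by (rule sum.cong) auto
    then show ?thesis using fin k0 CV(2) by simp
  qed
  have QQ: "Q * Q = 1\<^sub>m n"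
  proof (rule eq_matI)
    fix i j assume ij: "i < dim_row (1\<^sub>m n)" "j < dim_col (1\<^sub>m n)"
    then have "(Q * Q) $$ (i, j) = (\<Sum>l<n. q i l * q l j)"
      by (simp add: Q_def scalar_prod_def lessThan_atLeast0)
    also have "\<dots> = (if i = j then 1 else 0)"
      using ij qx[of i "\<lambda>l. q l j"] by (simp add: sumq) (simp add: q_def)
    finally show "(Q * Q) $$ (i, j) = 1\<^sub>m n $$ (i, j)" using ij by simp
  qed (simp_all add: Q_def)
  have QA: "?B * Q = Q * ?A"
  proof (rule eq_matI)
    fix i j assume "i < dim_row (Q * ?A)" "j < dim_col (Q * ?A)"
    then have ij: "i < n" "j < n" by (simp_all add: Q_def adj_matrix_def)
    have "(Q * ?A) $$ (i, j) = (\<Sum>l<n. q i l * a l j)"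
      using ij by (simp add: Q_def adj_matrix_def scalar_prod_def lessThan_atLeast0 a_def of_bool_def)
    also have "\<dots> = (if i \<in> C then of_nat (deg j) / of_nat k - a i j else a i j)"
    proof -
      have "(\<Sum>l\<in>C. a l j) = (\<Sum>l\<in>C. a j l)"
        unfolding a_def using sym ij CV(1) by (intro sum.cong) auto
      then show ?thesis using qx[OF ij(1), of "\<lambda>l. a l j"] suma by simp
    qed
    \<comment> \<open>If both indices lie in \<open>C\<close>, the common degree \<open>r\<close>
      makes the two quotients equal; the mixed cases are the formula in \<open>bout\<close>.\<close>
    also have "\<dots> = (if j \<in> C then of_nat (deg i) / of_nat k - b i j else b i j)"
      using bC[of i j] bout(1)[of i j] bout[of j i] r[of i] r[of j] ij by auto
    also have "\<dots> = (\<Sum>l<n. q j l * b i l)" using qx[OF ij(2), of "b i"] sumb[OF ij(1)] by simp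
    also have "\<dots> = (?B * Q) $$ (i, j)"
      using ij qsym by (simp add: Q_def adj_matrix_def scalar_prod_def lessThan_atLeast0 b_def of_bool_def mult.commute)
    finally show "(?B * Q) $$ (i, j) = (Q * ?A) $$ (i, j)" by simp
  qed (simp_all add: Q_def adj_matrix_def)
  have "Q * ?A * Q = ?B * Q * Q" using QA by simp
  also have "\<dots> = ?B * (Q * Q)" using adj_matrix_carrier Qc Qc by (rule assoc_mult_mat)
  also have "\<dots> = ?B" by (simp add: QQ right_mult_one_mat[OF adj_matrix_carrier])
  finally have "?B = Q * ?A * Q" by simp
  then show ?thesis using Qc QQ by (intro similar_matI[of _ _ Q Q n]) auto
qed

lemma Spec_cong: "similar_mat (adj_matrix n G) (adj_matrix n H) \<Longrightarrow> Spec n G = Spec n H"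
  by (simp add: Spec_def char_poly_similar)

section \<open>Passage between isomorphism classes and graphs on \<open>{0..<n}\<close>\<close>

lemma fgraph_if_is_graph: "is_graph n G \<Longrightarrow> fgraph {0..<n} G"
  unfolding is_graph_def fgraph_def by blast

lemma is_cograph_iff: "is_cograph n G \<longleftrightarrow> is_graph n G \<and> P4_free {0..<n} G"
  unfolding is_cograph_def P4_free_def P4_at_def by (simp add: Ball_def) blast

lemma graph_iso_iff: "graph_iso n G H \<longleftrightarrow> (\<exists>f. iso_via f {0..<n} G {0..<n} H)"
  by (simp add: graph_iso_def iso_via_def)

text \<open>The switched graph is the mate: it is not \<open>P4_free\<close>, hence not isomorphic
  to a cograph, and its complement arises by switching the complement.\<close>

lemma has_gc_mate_if_mated:
  assumes "is_cograph n G" "mated_graph {0..<n} G"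
  shows "has_gc_mate n G"
proof -
  have G: "is_graph n G" "P4_free {0..<n} G" using assms(1) by (simp_all add: is_cograph_iff)
  note V = fgraph_if_is_graph[OF G(1)]
  obtain C k where C: "switching_set {0..<n} G C k" and P: "\<not> P4_free {0..<n} (switch C k G)"
    using assms(2) unfolding mated_graph_def by blast
  \<comment> \<open>\<open>is_graph\<close> prescribes the value False outside
    \<open>{0..<n}\<close>, where \<open>fgraph\<close> says nothing.\<close>
  define H where "H = (\<lambda>i j. i < n \<and> j < n \<and> switch C k G i j)"
  have fs: "fgraph {0..<n} (switch C k G)" using V by (rule fgraph_switch)
  then have "is_graph n H"
    unfolding is_graph_def H_def fgraph_def by simp
  moreover have "\<not> graph_iso n G H"
  proof
    assume "graph_iso n G H"
    then obtain f where "iso_via f {0..<n} G {0..<n} H" using graph_iso_iff by blast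
    then have "P4_free {0..<n} H" using iso_via_inv P4_free_iso G(2) by blast
    moreover have "P4_free {0..<n} H = P4_free {0..<n} (switch C k G)"
      by (rule P4_free_cong) (simp add: H_def)
    ultimately show False using P by blast
  qed
  moreover have "Spec n G = Spec n H"
  proof -
    have "adj_matrix n H = adj_matrix n (switch C k G)" by (rule adj_matrix_cong) (simp add: H_def)
    then show ?thesis using Spec_cong[of n H G] switch_similar[OF V C] by simp
  qed
  moreover have "Spec n (complement n G) = Spec n (complement n H)"
  proof -
    have "adj_matrix n (complement n H) = adj_matrix n (switch C k (compl_rel G))"
      using switching_set_compl(2)[OF V C]
      by (intro adj_matrix_cong) (simp add: complement_def H_def compl_rel_def)
    moreover have "adj_matrix n (complement n G) = adj_matrix n (compl_rel G)"
      by (rule adj_matrix_cong) (simp add: complement_def compl_rel_def)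
    ultimately show ?thesis
      using Spec_cong[of n "complement n H" "complement n G"]
        switch_similar[OF fgraph_compl[OF V] switching_set_compl(1)[OF V C]] by simp
  qed
  ultimately show ?thesis unfolding has_gc_mate_def gen_cospectral_def graphs_def by blast
qed

text \<open>When the fibres agree, the set of pairs \<open>(f x, g x)\<close> projects injectively
  onto either image.\<close>

lemma card_image_eq:
  assumes "\<And>x y. x \<in> S \<Longrightarrow> y \<in> S \<Longrightarrow> f x = f y \<longleftrightarrow> g x = g y"
  shows "card (f ` S) = card (g ` S)"
proof -
  let ?P = "(\<lambda>x. (f x, g x)) ` S"
  have "inj_on fst ?P" "inj_on snd ?P" using assms by (auto simp: inj_on_def)
  moreover have "fst ` ?P = f ` S" "snd ` ?P = g ` S" by (simp_all add: image_image)
  ultimately show ?thesis by (metis card_image)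
qed

text \<open>The block of a graph under \<open>iso_rel\<close> and its value under \<open>cls\<close>
  determine each other. \<open>S\<close> need not be closed under isomorphism.\<close>

lemma card_quotient_iso:
  assumes "S \<subseteq> graphs n"
  shows "card (S // iso_rel n) = card ((\<lambda>G. cls {0..<n} G) ` S)"
proof -
  have iff: "(G, H) \<in> iso_rel n \<longleftrightarrow> G \<in> graphs n \<and> H \<in> graphs n \<and> cls {0..<n} G = cls {0..<n} H" for G H
  proof (cases "G \<in> graphs n \<and> H \<in> graphs n")
    case True
    then have "fgraph {0..<n} G" "fgraph {0..<n} H" by (simp_all add: graphs_def fgraph_if_is_graph)
    then show ?thesis using True by (simp add: iso_rel_def cls_eq_iff graph_iso_iff)
  qed (auto simp: iso_rel_def)
  have R: "iso_rel n `` {G} = {H \<in> graphs n. cls {0..<n} G = cls {0..<n} H}" if "G \<in> S" for G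
    using that assms by (auto simp: iff)
  have "S // iso_rel n = (\<lambda>G. iso_rel n `` {G}) ` S" unfolding quotient_def by blast
  moreover have "card ((\<lambda>G. iso_rel n `` {G}) ` S) = card ((\<lambda>G. cls {0..<n} G) ` S)"
  proof (rule card_image_eq)
    fix G H assume S: "G \<in> S" "H \<in> S"
    have "iso_rel n `` {G} = iso_rel n `` {H} \<longleftrightarrow> (G, H) \<in> iso_rel n"
    proof
      have "H \<in> iso_rel n `` {H}" using S(2) assms by (auto simp: iff)
      then show "iso_rel n `` {G} = iso_rel n `` {H} \<Longrightarrow> (G, H) \<in> iso_rel n" by auto
      show "(G, H) \<in> iso_rel n \<Longrightarrow> iso_rel n `` {G} = iso_rel n `` {H}"
        unfolding R[OF S(1)] R[OF S(2)] by (simp add: iff)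
    qed
    then show "iso_rel n `` {G} = iso_rel n `` {H} \<longleftrightarrow> cls {0..<n} G = cls {0..<n} H"
      using S assms by (auto simp: iff)
  qed
  ultimately show ?thesis by simp
qed

lemma ex_graph_cls:
  assumes "gsize c = n"
  obtains G where "is_graph n G" "c = cls {0..<n} G"
proof -
  obtain V E where VE: "fgraph V E" "c = cls V E" by (rule gclass_exhaust)
  then have "card V = n" "finite V" using assms by (simp_all add: gsize_cls fgraph_def)
  then obtain f where f: "bij_betw f {0..<n} V" using ex_bij_betw_nat_finite by metis
  define G where "G = (\<lambda>i j. i < n \<and> j < n \<and> E (f i) (f j))"
  have iso: "iso_via f {0..<n} G V E" using f by (simp add: iso_via_def G_def)
  then have G: "fgraph {0..<n} G" using iso_via_fgraph[OF iso_via_inv[OF iso] VE(1)] by simp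
  then have "cls {0..<n} G = cls V E" using cls_eq_iff[OF _ VE(1)] iso by blast
  moreover have "is_graph n G"
    using G unfolding is_graph_def fgraph_def atLeastLessThan_iff by (auto simp: G_def)
  ultimately show ?thesis using that VE(2) by simp
qed

lemma cls_image:
  "(\<lambda>G. cls {0..<n} G) ` {G \<in> graphs n. is_cograph n G} = {c. gsize c = n \<and> cograph c}"
proof (intro equalityI subsetI)
  fix c assume "c \<in> (\<lambda>G. cls {0..<n} G) ` {G \<in> graphs n. is_cograph n G}"
  then obtain G where "is_graph n G" "P4_free {0..<n} G" "c = cls {0..<n} G"
    by (auto simp: is_cograph_iff)
  then show "c \<in> {c. gsize c = n \<and> cograph c}"
    using fgraph_if_is_graph[of n G] by (simp add: gsize_cls cograph_cls)
next
  fix c assume "c \<in> {c. gsize c = n \<and> cograph c}"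
  then have c: "gsize c = n" "cograph c" by simp_all
  obtain G where G: "is_graph n G" "c = cls {0..<n} G" using c(1) by (rule ex_graph_cls)
  then have "is_cograph n G" using c(2) cograph_cls[OF fgraph_if_is_graph] by (simp add: is_cograph_iff)
  then show "c \<in> (\<lambda>G. cls {0..<n} G) ` {G \<in> graphs n. is_cograph n G}"
    using G by (simp add: graphs_def)
qed

lemma num_cographs_eq: "num_cographs n = card {c. gsize c = n \<and> cograph c}"
  unfolding num_cographs_def by (subst card_quotient_iso) (simp_all add: cls_image)

text \<open>A mated cograph has a mate, so every class missed by the count is unmated. It remains to
  show that unmated cographs are rare.\<close>

lemma num_cographs_mate_bounds:
  "num_cographs_mate n \<le> num_cographs n"
  "num_cographs n \<le> num_cographs_mate n + card {c. gsize c = n \<and> cograph c \<and> \<not> mated c}"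
proof -
  let ?M = "(\<lambda>G. cls {0..<n} G) ` {G \<in> graphs n. is_cograph n G \<and> has_gc_mate n G}"
  have M: "num_cographs_mate n = card ?M"
    unfolding num_cographs_mate_def by (rule card_quotient_iso) blast
  have fin: "finite {c. gsize c = n \<and> cograph c}" using finite_gsize[of n] by simp
  have "?M \<subseteq> {c. gsize c = n \<and> cograph c}" unfolding cls_image[symmetric] by blast
  then show "num_cographs_mate n \<le> num_cographs n"
    unfolding M num_cographs_eq by (rule card_mono[OF fin])
  then have finM: "finite ?M" using fin \<open>?M \<subseteq> _\<close> finite_subset by blast
  have "{c. gsize c = n \<and> cograph c} \<subseteq> ?M \<union> {c. gsize c = n \<and> cograph c \<and> \<not> mated c}"
  proof
    fix c assume "c \<in> {c. gsize c = n \<and> cograph c}"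
    then have c: "gsize c = n" "cograph c" by simp_all
    show "c \<in> ?M \<union> {c. gsize c = n \<and> cograph c \<and> \<not> mated c}"
    proof (cases "mated c")
      case True
      obtain G where G: "is_graph n G" "c = cls {0..<n} G" using c(1) by (rule ex_graph_cls)
      note V = fgraph_if_is_graph[OF G(1)]
      have "is_cograph n G" using c(2) cograph_cls[OF V] G by (simp add: is_cograph_iff)
      moreover have "mated_graph {0..<n} G" using True mated_cls[OF V] G(2) by simp
      ultimately have "has_gc_mate n G" by (rule has_gc_mate_if_mated)
      then show ?thesis using \<open>is_cograph n G\<close> G by (auto simp: graphs_def)
    qed (use c in simp)
  qed
  then have "card {c. gsize c = n \<and> cograph c} \<le> card (?M \<union> {c. gsize c = n \<and> cograph c \<and> \<not> mated c})"
    using finM finite_gsize[of n] by (intro card_mono) auto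
  also have "\<dots> \<le> card ?M + card {c. gsize c = n \<and> cograph c \<and> \<not> mated c}" by (rule card_Un_le)
  finally show "num_cographs n \<le> num_cographs_mate n + card {c. gsize c = n \<and> cograph c \<and> \<not> mated c}"
    unfolding M num_cographs_eq .
qed

section \<open>Comparison of growth rates\<close>

text \<open>The factor \<open>1 / (1 - x^n)\<close> of the product is \<open>exp (x^n + log_rem (x^n))\<close>; the series of
  the \<open>log_rem (x^n)\<close> still converges beyond \<open>\<rho>\<close>, up to \<open>sqrt \<rho>\<close>.\<close>

definition log_rem :: "real \<Rightarrow> real" where
  "log_rem u = - ln (1 - u) - u"

lemma exp_log_rem: "u < 1 \<Longrightarrow> exp (u + log_rem u) = 1 / (1 - u)"
  by (simp add: log_rem_def exp_minus inverse_eq_divide)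

lemma log_rem_nonneg: "u < 1 \<Longrightarrow> 0 \<le> log_rem u"
  using ln_le_minus_one[of "1 - u"] by (simp add: log_rem_def)

lemma log_rem_le:
  assumes "u < 1"
  shows "log_rem u \<le> u\<^sup>2 / (1 - u)"
proof -
  have "ln (1 / (1 - u)) \<le> 1 / (1 - u) - 1"
    using assms by (intro ln_le_minus_one) auto
  moreover have "ln (1 / (1 - u)) = - ln (1 - u)"
    using assms by (simp add: ln_div)
  moreover have "1 / (1 - u) - 1 - u = u\<^sup>2 / (1 - u)"
    using assms by (simp add: field_simps power2_eq_square)
  ultimately show ?thesis by (simp add: log_rem_def)
qed

text \<open>For \<open>b = sqrt \<rho>\<close> this is a multiple of \<open>\<rho> ^ n\<close>,
  uniformly in \<open>x\<close> up to \<open>sqrt \<rho>\<close>.\<close>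

lemma log_rem_power_le:
  assumes "0 \<le> x" "x \<le> b" "b < 1" "n \<ge> 1"
  shows "log_rem (x ^ n) \<le> (b\<^sup>2) ^ n / (1 - b)"
proof -
  have x: "x ^ n \<le> x" using assms power_decreasing[of 1 n x] by simp
  then have "log_rem (x ^ n) \<le> (x ^ n)\<^sup>2 / (1 - x ^ n)"
    using assms by (intro log_rem_le) auto
  also have "\<dots> \<le> (b ^ n)\<^sup>2 / (1 - b)"
    using x assms by (intro frac_le power_mono) auto
  finally show ?thesis by (simp add: power_mult [symmetric] mult.commute)
qed

lemma log_rem_power_le':
  assumes "0 \<le> x" "x < 1" "n \<ge> 1"
  shows "log_rem (x ^ n) \<le> x ^ n * (x / (1 - x))"
proof -
  have "x ^ n \<le> x ^ 1" using assms by (intro power_decreasing) auto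
  then have "x ^ n * x ^ n \<le> x ^ n * x" using assms by (intro mult_left_mono) auto
  then have "x ^ n * x ^ n / (1 - x) \<le> x ^ n * x / (1 - x)"
    using assms by (intro divide_right_mono) auto
  then show ?thesis using log_rem_power_le[of x x n] assms
    by (simp add: power2_eq_square power_mult_distrib)
qed

text \<open>The slope of \<open>exp\<close> is at least 1 at nonnegative arguments. A bound for a
  partial sum may thus be inserted although the sum also occurs with a minus sign.\<close>

lemma exp_minus_mono:
  assumes "0 \<le> a" "a \<le> b" "0 \<le> r" "r \<le> (s::real)"
  shows "exp (a + r) - a \<le> exp (b + s) - b"
proof -
  have "b - a \<le> exp (b - a) - 1" using exp_ge_add_one_self[of "b - a"] by linarith
  also have "\<dots> \<le> exp (a + r) * (exp (b - a) - 1)"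
    using mult_right_mono[of 1 "exp (a + r)" "exp (b - a) - 1"] assms by simp
  also have "\<dots> = exp (b + r) - exp (a + r)" by (simp add: algebra_simps flip: exp_add)
  also have "\<dots> \<le> exp (b + s) - exp (a + r)" using assms by simp
  finally show ?thesis by simp
qed

text \<open>At some \<open>x > \<rho>\<close> the terms \<open>w n * x ^ n\<close> stay below a
  constant, while for some \<open>z\<close> between \<rho> and \<open>x\<close> the terms
  \<open>t n * z ^ n\<close> are eventually bounded away from 0. Hence the ratio decays at least
  like \<open>(z / x) ^ n\<close>.\<close>

lemma growth_gap:
  fixes t w :: "nat \<Rightarrow> real"
  assumes t0: "t 0 = 0" and t1: "\<And>n. n \<ge> 1 \<Longrightarrow> t n \<ge> 1"
    and w: "\<And>n. 0 \<le> w n" "\<And>n. w n \<le> t n"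
    and super: "\<And>n k. n \<ge> 1 \<Longrightarrow> k \<ge> 1 \<Longrightarrow> n \<noteq> k \<Longrightarrow> t n * t k \<le> t (n + k)"
    and up_t: "\<And>x N. 0 < x \<Longrightarrow> x < 1 \<Longrightarrow>
      (\<Sum>n\<le>Suc N. t n * x ^ n) \<le>
        x + exp (\<Sum>n\<le>N. t n * (x ^ n + log_rem (x ^ n))) - 1 - (\<Sum>n\<le>N. t n * x ^ n)"
    and up_w: "\<And>x N. 0 < x \<Longrightarrow> x < 1 \<Longrightarrow> m \<le> Suc N \<Longrightarrow>
      (\<Sum>n\<le>Suc N. w n * x ^ n) \<le>
        x - x ^ m + exp (\<Sum>n\<le>N. w n * (x ^ n + log_rem (x ^ n))) - 1 - (\<Sum>n\<le>N. w n * x ^ n)"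
    and low_t: "\<And>x N. 0 < x \<Longrightarrow> x < 1 \<Longrightarrow> summable (\<lambda>n. t n * x ^ n) \<Longrightarrow>
      x + exp (\<Sum>n\<le>N. t n * (x ^ n + log_rem (x ^ n))) - 1 - (\<Sum>n\<le>N. t n * x ^ n) \<le> (\<Sum>n. t n * x ^ n)"
    and m: "m \<ge> 1"
  shows "(\<lambda>n. w n / t n) \<longlonglongrightarrow> 0"
proof -
  have tpos: "0 \<le> t n" for n using w(1)[of n] w(2)[of n] by linarith
  have t_pos: "0 < t n" if "n \<ge> 1" for n using t1[OF that] by linarith
  define S where "S = {x. 0 \<le> x \<and> summable (\<lambda>n. t n * x ^ n)}"
  define \<rho> where "\<rho> = Sup S"
  \<comment> \<open>Bootstrapping: at 1/16 the remainder adds at most a fifteenth to each term, and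
    a partial sum of at most 1/4 then keeps the next one below 1/5. So \<rho> is positive.\<close>
  have small: "(\<Sum>n\<le>N. t n * (1/16) ^ n) \<le> 1/4" for N
  proof (induction N)
    case 0 then show ?case by (simp add: t0)
  next
    case (Suc N)
    let ?y = "\<Sum>n\<le>N. t n * (1/16) ^ n"
    have y0: "0 \<le> ?y" using tpos by (intro sum_nonneg) simp
    have "(\<Sum>n\<le>N. t n * ((1/16) ^ n + log_rem ((1/16) ^ n))) \<le> (\<Sum>n\<le>N. 16/15 * (t n * (1/16) ^ n))"
    proof (rule sum_mono)
      fix n assume "n \<in> {..N}"
      show "t n * ((1/16) ^ n + log_rem ((1/16) ^ n)) \<le> 16/15 * (t n * (1/16) ^ n)"
      proof (cases "n = 0")
        case False
        then have "log_rem ((1/16) ^ n) \<le> (1/16) ^ n * ((1/16) / (1 - 1/16))"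
          by (intro log_rem_power_le') auto
        then have "u + log_rem u \<le> 16/15 * u" if "u = (1/16) ^ n" for u
          unfolding that [symmetric] by simp
        from mult_left_mono[OF this[OF refl] tpos] show ?thesis by (metis mult.left_commute)
      qed (simp add: t0)
    qed
    also have "\<dots> = 16/15 * ?y" by (simp add: sum_distrib_left)
    finally have "exp (\<Sum>n\<le>N. t n * ((1/16) ^ n + log_rem ((1/16) ^ n))) \<le> exp (16/15 * ?y)" by simp
    also have "\<dots> \<le> 1 + 16/15 * ?y + (16/15 * ?y)\<^sup>2"
      using y0 Suc by (intro exp_bound) auto
    also have "(16/15 * ?y)\<^sup>2 \<le> (16/15 * (1/4))\<^sup>2"
      using y0 Suc by (intro power_mono) auto
    finally show ?case using up_t[of "1/16" N] Suc by (simp add: power2_eq_square)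
  qed
  have "(1/16) \<in> S"
    unfolding S_def using small tpos by (auto intro!: bounded_imp_summable[where B = "1/4"])
  have summ_le: "summable (\<lambda>n. t n * x ^ n)" if "0 \<le> x" "x \<le> y" "summable (\<lambda>n. t n * y ^ n)" for x y
    by (rule summable_comparison_test'[OF that(3), of 0])
       (use that tpos in \<open>simp add: mult_left_mono power_mono\<close>)
  \<comment> \<open>Without remainders, \<open>low_t\<close> reads
    \<open>x + exp T - 1 - T \<le> T\<close> in the limit; the quadratic lower bound for
    \<open>exp\<close> leaves \<open>T * T \<le> 2 * T\<close>.\<close>
  have T2: "(\<Sum>n. t n * x ^ n) \<le> 2"
    if x: "0 < x" "x < 1" "summable (\<lambda>n. t n * x ^ n)" for x
  proof -
    let ?T = "\<Sum>n. t n * x ^ n"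
    have "x + exp (\<Sum>n\<le>N. t n * x ^ n) - 1 - (\<Sum>n\<le>N. t n * x ^ n) \<le> ?T" for N
    proof -
      have "(\<Sum>n\<le>N. t n * x ^ n) \<le> (\<Sum>n\<le>N. t n * (x ^ n + log_rem (x ^ n)))"
      proof (rule sum_mono)
        fix n assume "n \<in> {..N}"
        show "t n * x ^ n \<le> t n * (x ^ n + log_rem (x ^ n))"
        proof (cases "n = 0")
          case False
          then show ?thesis using x tpos[of n]
            by (intro mult_left_mono) (auto intro!: log_rem_nonneg simp: power_less_one_iff)
        qed (simp add: t0)
      qed
      then have "exp (\<Sum>n\<le>N. t n * x ^ n) \<le> exp (\<Sum>n\<le>N. t n * (x ^ n + log_rem (x ^ n)))"
        by simp
      then show ?thesis using low_t[OF x, of N] by linarith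
    qed
    moreover have "(\<lambda>N. \<Sum>n\<le>N. t n * x ^ n) \<longlonglongrightarrow> ?T"
      using summable_LIMSEQ'[OF x(3)] .
    then have "(\<lambda>N. x + exp (\<Sum>n\<le>N. t n * x ^ n) - 1 - (\<Sum>n\<le>N. t n * x ^ n)) \<longlonglongrightarrow> x + exp ?T - 1 - ?T"
      by (intro tendsto_intros)
    ultimately have "x + exp ?T - 1 - ?T \<le> ?T"
      by (intro LIMSEQ_le_const2[where X = "\<lambda>N. x + exp (\<Sum>n\<le>N. t n * x ^ n) - 1 - (\<Sum>n\<le>N. t n * x ^ n)"]) auto
    moreover have T0: "0 \<le> ?T" using x tpos by (intro suminf_nonneg) auto
    then have "1 + ?T + ?T\<^sup>2 / 2 \<le> exp ?T" by (rule exp_lower_Taylor_quadratic)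
    ultimately have "?T * ?T \<le> 2 * ?T" using x by (simp add: power2_eq_square)
    then show ?thesis using T0 by (cases "?T = 0") auto
  qed
  \<comment> \<open>With all \<open>t n \<ge> 1\<close>, four terms at 3/4 already exceed the bound
    2. This keeps \<rho>, and so \<open>sqrt \<rho>\<close>, below 1.\<close>
  have S34: "x \<le> 3/4" if "x \<in> S" for x
  proof (rule ccontr)
    assume "\<not> x \<le> 3/4"
    then have s: "summable (\<lambda>n. t n * (3/4) ^ n)" using that summ_le[of "3/4" x] by (auto simp: S_def)
    have "(\<Sum>n\<in>{1,2,3,4}. 1 * (3/4) ^ n) \<le> (\<Sum>n\<in>{1,2,3,4}. t n * (3/4) ^ n)"
      using t1 by (intro sum_mono mult_right_mono) auto
    also have "\<dots> \<le> (\<Sum>n. t n * (3/4) ^ n)"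
      using s tpos by (intro sum_le_suminf) auto
    also have "\<dots> \<le> 2" using s by (intro T2) auto
    finally show False by (simp add: power_numeral_reduce)
  qed
  have bdd: "bdd_above S" using S34 by (rule bdd_aboveI)
  have \<rho>16: "1/16 \<le> \<rho>" unfolding \<rho>_def using \<open>1/16 \<in> S\<close> bdd by (rule cSup_upper)
  have \<rho>34: "\<rho> \<le> 3/4" unfolding \<rho>_def using \<open>1/16 \<in> S\<close> S34 by (intro cSup_least) auto
  have below: "summable (\<lambda>n. t n * x ^ n)" if "0 \<le> x" "x < \<rho>" for x
  proof -
    obtain y where "y \<in> S" "x < y" using \<open>x < \<rho>\<close> \<open>1/16 \<in> S\<close> bdd less_cSup_iff[of S x]
      unfolding \<rho>_def by blast
    then show ?thesis using that summ_le[of x y] by (auto simp: S_def)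
  qed
  \<comment> \<open>The bound 2 passes from points left of \<rho> to \<rho> by continuity of the
    finite sums, so the series converges at \<rho> itself.\<close>
  have "(\<Sum>n\<le>N. t n * \<rho> ^ n) \<le> 2" for N
  proof (rule tendsto_upperbound)
    show "((\<lambda>x. \<Sum>n\<le>N. t n * x ^ n) \<longlongrightarrow> (\<Sum>n\<le>N. t n * \<rho> ^ n)) (at_left \<rho>)"
      by (intro tendsto_intros)
    have "\<forall>\<^sub>F x in at_left \<rho>. x \<in> {0<..<\<rho>}"
      using \<rho>16 by (intro eventually_at_left_real) auto
    then show "\<forall>\<^sub>F x in at_left \<rho>. (\<Sum>n\<le>N. t n * x ^ n) \<le> 2"
    proof eventually_elim
      case (elim x)
      then have s: "summable (\<lambda>n. t n * x ^ n)" by (intro below) auto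
      then have "(\<Sum>n\<le>N. t n * x ^ n) \<le> (\<Sum>n. t n * x ^ n)"
        using elim tpos by (intro sum_le_suminf) auto
      also have "\<dots> \<le> 2" using elim s \<rho>34 by (intro T2) auto
      finally show ?case .
    qed
  qed auto
  then have sum\<rho>: "summable (\<lambda>n. t n * \<rho> ^ n)"
    using tpos \<rho>16 by (intro bounded_imp_summable[where B = 2]) auto
  define \<tau> where "\<tau> = (\<Sum>n. t n * \<rho> ^ n)"
  define R where "R = (\<lambda>x. \<Sum>n. t n * log_rem (x ^ n))"
  have \<rho>sq: "0 < sqrt \<rho>" "sqrt \<rho> < 1" "\<rho> < sqrt \<rho>"
    using \<rho>16 \<rho>34 by (auto simp: real_less_rsqrt power2_eq_square mult_less_cancel_left1)
  have rem0: "0 \<le> log_rem (x ^ n)" if "0 \<le> x" "x < 1" "n \<noteq> 0" for x n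
    using that by (intro log_rem_nonneg) (auto simp: power_less_one_iff)
  have lt1: "x < 1" if "x \<in> {0..sqrt \<rho>}" for x
    using that \<rho>sq(2) unfolding atLeastAtMost_iff by linarith
  have bnd: "norm (t n * log_rem (x ^ n)) \<le> t n * \<rho> ^ n / (1 - sqrt \<rho>)" if "x \<in> {0..sqrt \<rho>}" for x n
  proof (cases "n = 0")
    case False
    then have "log_rem (x ^ n) \<le> ((sqrt \<rho>)\<^sup>2) ^ n / (1 - sqrt \<rho>)"
      using that \<rho>sq by (intro log_rem_power_le) auto
    moreover have "0 \<le> log_rem (x ^ n)"
      using that lt1[OF that] False by (intro rem0) auto
    moreover have "(sqrt \<rho>)\<^sup>2 = \<rho>" using \<rho>16 by simp
    ultimately show ?thesis
      using tpos[of n] mult_left_mono[of "log_rem (x ^ n)" "\<rho> ^ n / (1 - sqrt \<rho>)" "t n"]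
      by (simp add: abs_mult)
  qed (simp add: t0)
  have summ_bnd: "summable (\<lambda>n. t n * \<rho> ^ n / (1 - sqrt \<rho>))"
    using sum\<rho> by (rule summable_divide)
  have Rsum: "summable (\<lambda>n. t n * log_rem (x ^ n))" if "x \<in> {0..sqrt \<rho>}" for x
    by (rule summable_comparison_test'[OF summ_bnd bnd[OF that]])
  \<comment> \<open>Weierstrass M-test with the majorant from \<open>bnd\<close>; continuity to the
    right of \<rho> is what matters below.\<close>
  have Rcont: "continuous_on {0..sqrt \<rho>} R"
  proof -
    have ul: "uniform_limit {0..sqrt \<rho>} (\<lambda>N x. \<Sum>n<N. t n * log_rem (x ^ n)) R sequentially"
      unfolding R_def by (rule Weierstrass_m_test[OF _ summ_bnd]) (use bnd in auto)
    have "continuous_on {0..sqrt \<rho>} (\<lambda>x. t n * log_rem (x ^ n))" for n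
    proof (cases "n = 0")
      case False
      then have "x ^ n < 1" if "x \<in> {0..sqrt \<rho>}" for x
        using that lt1[OF that] False by (auto simp: power_less_one_iff)
      then show ?thesis unfolding log_rem_def
        by (intro continuous_intros) (auto simp: less_le)
    qed (simp add: t0)
    then show ?thesis
      by (intro uniform_limit_theorem[OF _ ul]) (auto intro!: always_eventually continuous_on_sum)
  qed
  define h where "h = (\<lambda>x. x - x ^ m + exp (\<tau> + R x) - 1 - \<tau>)"
  define q where "q = (\<lambda>x. \<Sum>n<m. t n * x ^ n)"
  have "\<rho> + exp (\<tau> + R \<rho>) - 1 - \<tau> \<le> \<tau>"
  proof (rule LIMSEQ_le_const2)
    have "(\<lambda>N. \<Sum>n\<le>N. t n * log_rem (\<rho> ^ n)) \<longlonglongrightarrow> R \<rho>"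
      unfolding R_def using \<rho>sq \<rho>16 by (intro summable_LIMSEQ' Rsum) auto
    moreover have "(\<lambda>N. \<Sum>n\<le>N. t n * \<rho> ^ n) \<longlonglongrightarrow> \<tau>"
      unfolding \<tau>_def using sum\<rho> by (rule summable_LIMSEQ')
    ultimately show "(\<lambda>N. \<rho> + exp ((\<Sum>n\<le>N. t n * \<rho> ^ n) + (\<Sum>n\<le>N. t n * log_rem (\<rho> ^ n))) - 1 -
        (\<Sum>n\<le>N. t n * \<rho> ^ n)) \<longlonglongrightarrow> \<rho> + exp (\<tau> + R \<rho>) - 1 - \<tau>"
      by (intro tendsto_intros)
    show "\<exists>N. \<forall>n\<ge>N. \<rho> + exp ((\<Sum>n\<le>n. t n * \<rho> ^ n) + (\<Sum>n\<le>n. t n * log_rem (\<rho> ^ n))) - 1 -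
        (\<Sum>n\<le>n. t n * \<rho> ^ n) \<le> \<tau>"
      using low_t[of \<rho>] \<rho>16 \<rho>34 sum\<rho> by (simp add: \<tau>_def sum.distrib distrib_left)
  qed
  \<comment> \<open>The term \<open>\<rho> ^ m\<close> makes the inequality strict, which gives room
    to the right of \<rho>.\<close>
  then have h\<rho>: "h \<rho> < \<tau>" using \<rho>16 zero_less_power[of \<rho> m] unfolding h_def by linarith
  have q\<rho>: "q \<rho> < \<tau>"
  proof -
    have "0 < t m * \<rho> ^ m" using t1[OF m] \<rho>16 by (intro mult_pos_pos) auto
    then have "q \<rho> < (\<Sum>n<Suc m. t n * \<rho> ^ n)" by (simp add: q_def)
    also have "\<dots> \<le> \<tau>" unfolding \<tau>_def using sum\<rho> tpos \<rho>16 by (intro sum_le_suminf) auto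
    finally show ?thesis .
  qed
  obtain x where x: "\<rho> < x" "x < sqrt \<rho>" "h x < \<tau>" "q x < \<tau>"
  proof -
    have c: "continuous_on {0<..<sqrt \<rho>} h"
      unfolding h_def by (intro continuous_intros continuous_on_subset[OF Rcont]) auto
    then have "(h \<longlongrightarrow> h \<rho>) (at_right \<rho>)"
      using \<rho>sq \<rho>16 by (auto simp: continuous_on_eq_continuous_at isCont_def intro: filterlim_at_split[THEN iffD1, THEN conjunct2])
    then have "\<forall>\<^sub>F x in at_right \<rho>. h x < \<tau>" using h\<rho> by (rule order_tendstoD)
    moreover have "(q \<longlongrightarrow> q \<rho>) (at_right \<rho>)" unfolding q_def by (intro tendsto_intros)
    then have "\<forall>\<^sub>F x in at_right \<rho>. q x < \<tau>" using q\<rho> by (rule order_tendstoD)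
    moreover have "\<forall>\<^sub>F x in at_right \<rho>. x \<in> {\<rho><..<sqrt \<rho>}"
      using \<rho>sq by (intro eventually_at_right_real) auto
    ultimately have "\<forall>\<^sub>F x in at_right \<rho>. \<rho> < x \<and> x < sqrt \<rho> \<and> h x < \<tau> \<and> q x < \<tau>"
      by eventually_elim auto
    then show ?thesis using that eventually_happens'[of "at_right \<rho>"] by fastforce
  qed
  have x01: "0 < x" "x < 1" using x \<rho>16 lt1[of x] by auto
  \<comment> \<open>Induction on \<open>N\<close>: below \<open>m\<close> by comparison with
    \<open>q x\<close>, afterwards because a partial sum of at most \<tau> forces the next one to be
    at most \<open>h x < \<tau>\<close>.\<close>
  have W: "(\<Sum>n\<le>N. w n * x ^ n) \<le> \<tau>" for N
  proof (induction N rule: nat_less_induct)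
    case (1 N)
    show ?case
    proof (cases "N < m")
      case True
      have "(\<Sum>n\<le>N. w n * x ^ n) \<le> (\<Sum>n\<le>N. t n * x ^ n)"
        using w x01 by (intro sum_mono mult_right_mono) auto
      also have "\<dots> \<le> q x" unfolding q_def using True tpos x01 by (intro sum_mono2) auto
      finally show ?thesis using x by simp
    next
      case False
      then obtain N' where N: "N = Suc N'" "m \<le> Suc N'" using m by (cases N) auto
      have "0 \<le> w 0" "w 0 \<le> 0" using w[of 0] t0 by auto
      then have w0: "w 0 = 0" by simp
      have rw: "0 \<le> w n * log_rem (x ^ n)" for n
        using w(1)[of n] rem0[of x n] x01 w0 by (cases "n = 0") auto
      have rt: "w n * log_rem (x ^ n) \<le> t n * log_rem (x ^ n)" for n
        using w(2)[of n] rem0[of x n] x01 w0 t0 by (cases "n = 0") (auto intro: mult_right_mono)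
      have "(\<Sum>n\<le>N'. w n * log_rem (x ^ n)) \<le> (\<Sum>n\<le>N'. t n * log_rem (x ^ n))"
        using rt by (rule sum_mono)
      also have "\<dots> \<le> R x" unfolding R_def
        using rw rt x x01 by (intro sum_le_suminf Rsum) (auto intro: order_trans)
      finally have "exp ((\<Sum>n\<le>N'. w n * x ^ n) + (\<Sum>n\<le>N'. w n * log_rem (x ^ n))) - (\<Sum>n\<le>N'. w n * x ^ n)
         \<le> exp (\<tau> + R x) - \<tau>"
        using 1 N w x01 rw by (intro exp_minus_mono) (auto intro!: sum_nonneg)
      then show ?thesis using up_w[OF x01 N(2)] x N
        by (simp add: h_def sum.distrib distrib_left)
    qed
  qed
  obtain z where z: "\<rho> < z" "z < x" using x dense by blast
  have z01: "0 < z" "z < 1" using z \<rho>16 x01 by auto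
  \<comment> \<open>If all terms at \<open>z\<close> were at most 1, comparison with a geometric
    series would give convergence at a point between \<rho> and \<open>z\<close>, against the choice
    of \<rho> as a supremum.\<close>
  obtain k where k: "k \<ge> 1" "1 \<le> t k * z ^ k"
  proof (rule ccontr)
    assume "\<not> thesis"
    then have less: "t k * z ^ k \<le> 1" for k using that[of k] t0 by (cases k) force+
    obtain y where y: "\<rho> < y" "y < z" using z dense by blast
    have "summable (\<lambda>n. t n * y ^ n)"
    proof (rule summable_comparison_test')
      show "summable (\<lambda>n. (y / z) ^ n)" using y z01 \<rho>16 by (intro summable_geometric) auto
      show "norm (t n * y ^ n) \<le> (y / z) ^ n" for n
        using less[of n] mult_right_mono[OF less[of n], of "(y / z) ^ n"] y z01 \<rho>16 tpos[of n]
        by (simp add: power_divide field_simps)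
    qed
    then have "y \<in> S" using y \<rho>16 by (simp add: S_def)
    then show False using y cSup_upper[OF _ bdd, of y] by (simp add: \<rho>_def)
  qed
  \<comment> \<open>Multiplying by \<open>t k * z ^ k \<ge> 1\<close> carries the lower bound from
    the window \<open>k+1\<close> to \<open>2*k\<close> to all larger indices. Beyond the window
    \<open>n - k > k\<close>, so \<open>super\<close> applies to distinct indices.\<close>
  define c where "c = Min ((\<lambda>n. t n * z ^ n) ` {k+1..2*k})"
  have c0: "0 < c" unfolding c_def using k z01 t_pos
    by (auto simp: Min_gr_iff intro!: mult_pos_pos)
  have low: "c \<le> t n * z ^ n" if "n > k" for n
    using that
  proof (induction n rule: less_induct)
    case (less n)
    show ?case
    proof (cases "n \<le> 2 * k")
      case True then show ?thesis using less unfolding c_def by (intro Min_le) auto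
    next
      case False
      then have "c \<le> t (n - k) * z ^ (n - k)" using k by (intro less) auto
      also have "\<dots> \<le> (t (n - k) * z ^ (n - k)) * (t k * z ^ k)"
        using mult_left_mono[OF k(2), of "t (n - k) * z ^ (n - k)"] tpos z01 by simp
      also have "\<dots> = (t (n - k) * t k) * (z ^ (n - k) * z ^ k)" by simp
      also have "\<dots> = (t (n - k) * t k) * z ^ n" using False by (simp flip: power_add)
      also have "\<dots> \<le> t n * z ^ n"
        using super[of "n - k" k] False k z01 by (intro mult_right_mono) auto
      finally show ?thesis .
    qed
  qed
  show ?thesis
  proof (rule tendsto_sandwich)
    show "\<forall>\<^sub>F n in sequentially. 0 \<le> w n / t n" using w tpos by simp
    show "\<forall>\<^sub>F n in sequentially. w n / t n \<le> \<tau> / c * (z / x) ^ n"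
      using eventually_gt_at_top[of k]
    proof eventually_elim
      case (elim n)
      have "w n * x ^ n \<le> (\<Sum>n\<le>n. w n * x ^ n)" using w x01 by (intro member_le_sum) auto
      then have "w n * x ^ n \<le> \<tau>" using W[of n] by linarith
      moreover from this have "0 \<le> \<tau>" using w(1)[of n] x01 order_trans[of 0 "w n * x ^ n" \<tau>] by simp
      ultimately have "w n * x ^ n / (t n * z ^ n) \<le> \<tau> / c"
        using low[OF elim] c0 w x01 by (intro frac_le) auto
      then have "w n * x ^ n / (t n * z ^ n) * (z / x) ^ n \<le> \<tau> / c * (z / x) ^ n"
        using x01 z01 by (intro mult_right_mono) auto
      moreover have "w n * x ^ n / (t n * z ^ n) * (z / x) ^ n = w n / t n"
        using x01 z01 by (simp add: power_divide)
      ultimately show ?case by simp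
    qed
    have "(\<lambda>n. (z / x) ^ n) \<longlonglongrightarrow> 0" using z z01 x01 by (intro LIMSEQ_realpow_zero) auto
    then show "(\<lambda>n. \<tau> / c * (z / x) ^ n) \<longlonglongrightarrow> 0" by (rule tendsto_mult_right_zero)
  qed simp
qed

section \<open>Counting connected cographs\<close>

lemma gsize_pos: "c \<noteq> 0 \<Longrightarrow> 0 < gsize c"
  using gsize_eq_0_iff[of c] by linarith

lemma not_connected_plus: "a \<noteq> 0 \<Longrightarrow> b \<noteq> 0 \<Longrightarrow> \<not> gconnected (a + b)"
  unfolding gconnected_def by blast

text \<open>Since \<open>c\<close> is not itself a single component, removing one leaves a nonzero
  rest.\<close>

lemma not_connected_components:
  assumes "\<not> gconnected c"
  obtains M where "c = sum_mset M" "\<And>s. s \<in># M \<Longrightarrow> gconnected s \<and> gsize s < gsize c"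
proof -
  obtain M where M: "\<forall>s\<in>#M. gconnected s" "c = sum_mset M" using ex_connected_sum by blast
  have "gsize s < gsize c" if s: "s \<in># M" for s
  proof -
    obtain M' where M': "M = add_mset s M'" using s by (rule mset_add)
    then have c: "c = s + sum_mset M'" using M(2) by simp
    then have "sum_mset M' \<noteq> 0" using assms M(1) s by auto
    then show ?thesis using gsize_pos c by simp
  qed
  then show ?thesis using that M by blast
qed

section \<open>Multisets of classes and finite Euler products\<close>

definition bounded_msets :: "'a set \<Rightarrow> nat \<Rightarrow> 'a multiset set" where
  "bounded_msets S K = {M. set_mset M \<subseteq> S \<and> (\<forall>s. count M s \<le> K)}"

lemma bounded_msets_insert:
  assumes "a \<notin> S"
  shows "bij_betw (\<lambda>(k, M). replicate_mset k a + M) ({..K} \<times> bounded_msets S K)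
    (bounded_msets (insert a S) K)"
proof (rule bij_betw_byWitness[where f' = "\<lambda>M. (count M a, filter_mset (\<lambda>s. s \<noteq> a) M)"])
  let ?f = "\<lambda>(k, M). replicate_mset k a + M"
  let ?g = "\<lambda>M. (count M a, filter_mset (\<lambda>s. s \<noteq> a) M)"
  have a: "a \<notin># M" if "M \<in> bounded_msets S K" for M
    using that assms by (auto simp: bounded_msets_def)
  show "\<forall>p\<in>{..K} \<times> bounded_msets S K. ?g (?f p) = p"
  proof
    fix p assume "p \<in> {..K} \<times> bounded_msets S K"
    then obtain k M where p: "p = (k, M)" "M \<in> bounded_msets S K" by blast
    have "filter_mset (\<lambda>s. s \<noteq> a) M = M"
      by (rule multiset_eqI) (use a[OF p(2)] in \<open>auto simp: not_in_iff\<close>)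
    moreover have "count M a = 0" using a[OF p(2)] by (simp add: not_in_iff)
    ultimately show "?g (?f p) = p" by (simp add: p(1))
  qed
  show "\<forall>M\<in>bounded_msets (insert a S) K. ?f (?g M) = M"
    by (auto intro!: multiset_eqI)
  show "?f ` ({..K} \<times> bounded_msets S K) \<subseteq> bounded_msets (insert a S) K"
  proof
    fix N assume "N \<in> ?f ` ({..K} \<times> bounded_msets S K)"
    then obtain k M where N: "N = replicate_mset k a + M" "k \<le> K" "M \<in> bounded_msets S K" by auto
    have "count N s \<le> K" for s
      using N a[OF N(3)] by (cases "s = a") (auto simp: bounded_msets_def not_in_iff)
    moreover have "set_mset N \<subseteq> insert a S" using N by (auto simp: bounded_msets_def)
    ultimately show "N \<in> bounded_msets (insert a S) K" by (simp add: bounded_msets_def)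
  qed
  show "?g ` bounded_msets (insert a S) K \<subseteq> {..K} \<times> bounded_msets S K"
    by (auto simp: bounded_msets_def)
qed

text \<open>Expanding a product of truncated geometric sums: a choice of exponents up to
  \<open>K\<close> is a multiset with multiplicities up to \<open>K\<close>.\<close>

lemma sum_bounded_msets:
  fixes y :: "'a \<Rightarrow> real"
  assumes "finite S"
  shows "finite (bounded_msets S K) \<and>
    (\<Sum>M\<in>bounded_msets S K. \<Prod>s\<in>#M. y s) = (\<Prod>s\<in>S. \<Sum>k\<le>K. y s ^ k)"
  using assms
proof (induction S rule: finite_induct)
  case empty
  have "bounded_msets ({} :: 'a set) K = {{#}}" by (auto simp: bounded_msets_def)
  then show ?case by simp
next
  case (insert a S)
  note bij = bounded_msets_insert[OF insert.hyps(2), of K]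
  have "finite ({..K} \<times> bounded_msets S K)" using insert.IH by blast
  then have fin: "finite (bounded_msets (insert a S) K)" using bij_betw_finite[OF bij] by blast
  have "(\<Sum>M\<in>bounded_msets (insert a S) K. \<Prod>s\<in>#M. y s) =
      (\<Sum>p\<in>{..K} \<times> bounded_msets S K. \<Prod>s\<in>#(case p of (k, M) \<Rightarrow> replicate_mset k a + M). y s)"
    using sum.reindex_bij_betw[OF bij, of "\<lambda>M. \<Prod>s\<in>#M. y s"] by simp
  also have "\<dots> = (\<Sum>(k, M)\<in>{..K} \<times> bounded_msets S K. y a ^ k * (\<Prod>s\<in>#M. y s))"
    by (rule sum.cong) auto
  also have "\<dots> = (\<Sum>k\<le>K. y a ^ k) * (\<Sum>M\<in>bounded_msets S K. \<Prod>s\<in>#M. y s)"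
    by (simp add: sum_product sum.cartesian_product)
  finally have "(\<Sum>M\<in>bounded_msets (insert a S) K. \<Prod>s\<in>#M. y s) = (\<Prod>s\<in>insert a S. \<Sum>k\<le>K. y s ^ k)"
    using insert by simp
  with fin show ?case by blast
qed

lemma power_gsize_sum_mset: "(x :: real) ^ gsize (sum_mset M) = (\<Prod>s\<in>#M. x ^ gsize s)"
  by (induction M) (simp_all add: power_add)

text \<open>Distinct classes have distinct representing multisets, so the left side is part of the
  expanded Euler product over \<open>S\<close>.\<close>

lemma sum_of_sums_le:
  fixes x :: real
  assumes S: "finite S" "\<And>s. s \<in> S \<Longrightarrow> s \<noteq> 0" and x: "0 < x" "x < 1"
    and F: "finite F" "\<And>c. c \<in> F \<Longrightarrow> \<exists>M. set_mset M \<subseteq> S \<and> c = sum_mset M"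
  shows "(\<Sum>c\<in>F. x ^ gsize c) \<le> (\<Prod>s\<in>S. 1 / (1 - x ^ gsize s))"
proof -
  obtain m where m: "\<And>c. c \<in> F \<Longrightarrow> set_mset (m c) \<subseteq> S \<and> c = sum_mset (m c)" using F(2) by metis
  \<comment> \<open>Any common bound for the multiplicities in the finitely many multisets
    serves.\<close>
  define K where "K = (\<Sum>c\<in>F. size (m c))"
  have "count (m c) s \<le> K" if "c \<in> F" for c s
  proof -
    have "count (m c) s \<le> size (m c)" by (rule count_le_size)
    also have "\<dots> \<le> K" unfolding K_def using that F(1) by (intro member_le_sum) auto
    finally show ?thesis .
  qed
  then have sub: "m ` F \<subseteq> bounded_msets S K" using m by (auto simp: bounded_msets_def)
  have inj: "inj_on m F" using m by (metis inj_onI)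
  have "(\<Sum>c\<in>F. x ^ gsize c) = (\<Sum>c\<in>F. \<Prod>s\<in>#m c. x ^ gsize s)"
  proof (rule sum.cong)
    fix c assume "c \<in> F"
    then have "x ^ gsize c = x ^ gsize (sum_mset (m c))" using m by metis
    then show "x ^ gsize c = (\<Prod>s\<in>#m c. x ^ gsize s)" by (simp only: power_gsize_sum_mset)
  qed simp
  also have "\<dots> = (\<Sum>M\<in>m ` F. \<Prod>s\<in>#M. x ^ gsize s)" using inj by (simp add: sum.reindex)
  also have "\<dots> \<le> (\<Sum>M\<in>bounded_msets S K. \<Prod>s\<in>#M. x ^ gsize s)"
    using sub sum_bounded_msets[OF S(1)] x
    by (intro sum_mono2) (auto simp flip: power_gsize_sum_mset)
  also have "\<dots> = (\<Prod>s\<in>S. \<Sum>k\<le>K. (x ^ gsize s) ^ k)" using sum_bounded_msets[OF S(1)] by blast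
  also have "\<dots> \<le> (\<Prod>s\<in>S. 1 / (1 - x ^ gsize s))"
  proof (rule prod_mono)
    fix s assume s: "s \<in> S"
    have y: "0 \<le> x ^ gsize s" "x ^ gsize s < 1"
      using x gsize_pos[OF S(2)[OF s]] by (auto simp: power_less_one_iff)
    have "(\<Sum>k\<le>K. (x ^ gsize s) ^ k) \<le> (\<Sum>k. (x ^ gsize s) ^ k)"
      using y by (intro sum_le_suminf summable_geometric) auto
    also have "\<dots> = 1 / (1 - x ^ gsize s)" using y by (intro suminf_geometric) auto
    finally show "0 \<le> (\<Sum>k\<le>K. (x ^ gsize s) ^ k) \<and> (\<Sum>k\<le>K. (x ^ gsize s) ^ k) \<le> 1 / (1 - x ^ gsize s)"
      using y by (auto intro!: sum_nonneg)
  qed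
  finally show ?thesis .
qed

definition num :: "gclass set \<Rightarrow> nat \<Rightarrow> nat" where
  "num Z n = card {c \<in> Z. gsize c = n}"

lemma finite_gsize_le: "finite {c \<in> Z. gsize c \<le> N}"
proof -
  have "{c \<in> Z. gsize c \<le> N} \<subseteq> (\<Union>n\<le>N. {c. gsize c = n})" by auto
  then show ?thesis by (rule finite_subset) (simp add: finite_gsize)
qed

lemma sum_by_gsize:
  fixes g :: "nat \<Rightarrow> real"
  shows "(\<Sum>c\<in>{c \<in> Z. gsize c \<le> N}. g (gsize c)) = (\<Sum>n\<le>N. real (num Z n) * g n)"
proof -
  have "(\<Sum>c\<in>{c \<in> Z. gsize c \<le> N}. g (gsize c)) =
    (\<Sum>n\<le>N. \<Sum>c\<in>{c \<in> {c \<in> Z. gsize c \<le> N}. gsize c = n}. g (gsize c))"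
    using finite_gsize_le by (intro sum.group[symmetric]) auto
  also have "\<dots> = (\<Sum>n\<le>N. real (num Z n) * g n)"
  proof (rule sum.cong)
    fix n assume "n \<in> {..N}"
    then have "{c \<in> {c \<in> Z. gsize c \<le> N}. gsize c = n} = {c \<in> Z. gsize c = n}" by auto
    then show "(\<Sum>c\<in>{c \<in> {c \<in> Z. gsize c \<le> N}. gsize c = n}. g (gsize c)) = real (num Z n) * g n"
      by (simp add: num_def)
  qed simp
  finally show ?thesis .
qed

lemma prod_by_gsize:
  fixes x :: real
  assumes "0 < x" "x < 1" "0 \<notin> Z"
  shows "(\<Prod>s\<in>{c \<in> Z. gsize c \<le> N}. 1 / (1 - x ^ gsize s)) =
    exp (\<Sum>n\<le>N. real (num Z n) * (x ^ n + log_rem (x ^ n)))"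
proof -
  have "(\<Prod>s\<in>{c \<in> Z. gsize c \<le> N}. 1 / (1 - x ^ gsize s)) =
      (\<Prod>s\<in>{c \<in> Z. gsize c \<le> N}. exp (x ^ gsize s + log_rem (x ^ gsize s)))"
  proof (rule prod.cong)
    fix s assume "s \<in> {c \<in> Z. gsize c \<le> N}"
    then have "s \<noteq> 0" using assms(3) by auto
    then have "0 < gsize s" by (rule gsize_pos)
    then have "x ^ gsize s < 1" using assms by (simp add: power_less_one_iff)
    then show "1 / (1 - x ^ gsize s) = exp (x ^ gsize s + log_rem (x ^ gsize s))"
      by (simp add: exp_log_rem)
  qed simp
  also have "\<dots> = exp (\<Sum>s\<in>{c \<in> Z. gsize c \<le> N}. x ^ gsize s + log_rem (x ^ gsize s))"
    using finite_gsize_le by (simp add: exp_sum)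
  also have "(\<Sum>s\<in>{c \<in> Z. gsize c \<le> N}. x ^ gsize s + log_rem (x ^ gsize s)) =
      (\<Sum>n\<le>N. real (num Z n) * (x ^ n + log_rem (x ^ n)))"
    by (rule sum_by_gsize)
  finally show ?thesis .
qed

section \<open>Inequalities for the numbers of connected cographs\<close>

definition conn_cographs :: "gclass set" where
  "conn_cographs = {c. gconnected c \<and> cograph c}"

lemma zero_notin_conn: "0 \<notin> conn_cographs"
  by (simp add: conn_cographs_def gconnected_def)

lemma co_conn:
  assumes "\<not> gconnected c" "cograph c" "gsize c \<ge> 2"
  shows "co c \<in> conn_cographs"
  using assms connected_co_iff[of c] by (simp add: conn_cographs_def)

text \<open>The empty sum, the members of \<open>Z\<close> up to size \<open>N\<close>, the
  complements of those with 2 to \<open>Suc N\<close> vertices, and the elements of \<open>D\<close>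
  are distinct sums of members of size at most \<open>N\<close>. \<open>comp\<close> keeps the
  components of complements inside \<open>Z\<close>; \<open>D\<close> holds sums that are lost
  because no member of \<open>Z\<close> is their complement.\<close>

lemma upper_bound:
  fixes x :: real
  assumes x: "0 < x" "x < 1" and Z: "Z \<subseteq> conn_cographs"
    and comp: "\<And>c s M. c \<in> Z \<Longrightarrow> co c = sum_mset M \<Longrightarrow> s \<in># M \<Longrightarrow> gconnected s \<Longrightarrow> s \<in> Z"
    and D: "finite D" "0 \<notin> D" "\<And>d. d \<in> D \<Longrightarrow> \<not> gconnected d \<and> d \<notin> co ` Z"
    and Dsum: "\<And>d. d \<in> D \<Longrightarrow> \<exists>M. set_mset M \<subseteq> {c \<in> Z. gsize c \<le> N} \<and> d = sum_mset M"
  shows "(\<Sum>n\<le>Suc N. real (num Z n) * x ^ n) \<le> x - (\<Sum>d\<in>D. x ^ gsize d) +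
    exp (\<Sum>n\<le>N. real (num Z n) * (x ^ n + log_rem (x ^ n))) - 1 - (\<Sum>n\<le>N. real (num Z n) * x ^ n)"
proof -
  let ?S = "{c \<in> Z. gsize c \<le> N}"
  \<comment> \<open>One size further than \<open>?S\<close>: these complements are disconnected, so
    their components have at most \<open>N\<close> vertices.\<close>
  let ?L = "{c \<in> Z. gsize c \<le> Suc N \<and> gsize c \<ge> 2}"
  have Zc: "gconnected c" "cograph c" if "c \<in> Z" for c
    using that Z unfolding conn_cographs_def by blast+
  have "0 \<notin> Z" using Z zero_notin_conn by blast
  have finS: "finite ?S" by (rule finite_gsize_le)
  have finL: "finite ?L" by (rule finite_subset[OF _ finite_gsize_le[of Z "Suc N"]]) blast
  have Lco: "\<not> gconnected (co c)" if "c \<in> ?L" for c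
    using connected_co_iff[of c] Zc[of c] that by blast
  have inj: "inj_on co ?L" by (rule inj_on_inverseI[where g = co]) simp
  have dis: "{0} \<inter> ?S = {}" "({0} \<union> ?S) \<inter> co ` ?L = {}" "({0} \<union> ?S \<union> co ` ?L) \<inter> D = {}"
  proof -
    show "{0} \<inter> ?S = {}" using \<open>0 \<notin> Z\<close> by blast
    have "co c \<noteq> 0" if "c \<in> ?L" for c
      using that gsize_co[of c] gsize_eq_0_iff[of "co c"] by auto
    then show "({0} \<union> ?S) \<inter> co ` ?L = {}" using Lco Zc(1) by fastforce
    show "({0} \<union> ?S \<union> co ` ?L) \<inter> D = {}" using D(2,3) Zc(1) by blast
  qed
  have "(\<Sum>c\<in>{0} \<union> ?S \<union> co ` ?L \<union> D. x ^ gsize c) \<le> (\<Prod>s\<in>?S. 1 / (1 - x ^ gsize s))"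
  proof (rule sum_of_sums_le[OF finS _ x])
    show "s \<noteq> 0" if "s \<in> ?S" for s using that \<open>0 \<notin> Z\<close> by auto
    show "finite ({0} \<union> ?S \<union> co ` ?L \<union> D)" using finS finL D(1) by blast
    fix c assume "c \<in> {0} \<union> ?S \<union> co ` ?L \<union> D"
    then consider "c = 0" | "c \<in> ?S" | "c \<in> co ` ?L" | "c \<in> D" by blast
    then show "\<exists>M. set_mset M \<subseteq> ?S \<and> c = sum_mset M"
    proof cases
      case 1 then show ?thesis by (intro exI[of _ "{#}"]) simp
    next
      case 2 then show ?thesis by (intro exI[of _ "{#c#}"]) simp
    next
      case 3
      then obtain c' where c': "c' \<in> ?L" "c = co c'" by blast
      then obtain M where M: "c = sum_mset M" "\<And>s. s \<in># M \<Longrightarrow> gconnected s \<and> gsize s < gsize c"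
        using not_connected_components Lco by metis
      have "set_mset M \<subseteq> ?S"
      proof
        fix s assume s: "s \<in># M"
        then have "s \<in> Z" using comp[of c' M s] c' M by auto
        then show "s \<in> ?S" using M(2)[OF s] c' by simp
      qed
      then show ?thesis using M(1) by blast
    next
      case 4 then show ?thesis by (rule Dsum)
    qed
  qed
  also have "(\<Prod>s\<in>?S. 1 / (1 - x ^ gsize s)) =
      exp (\<Sum>n\<le>N. real (num Z n) * (x ^ n + log_rem (x ^ n)))"
    using x \<open>0 \<notin> Z\<close> by (rule prod_by_gsize)
  also have "(\<Sum>c\<in>{0} \<union> ?S \<union> co ` ?L \<union> D. x ^ gsize c) =
      1 + (\<Sum>c\<in>?S. x ^ gsize c) + (\<Sum>c\<in>?L. x ^ gsize c) + (\<Sum>d\<in>D. x ^ gsize d)"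
  proof -
    have "(\<Sum>c\<in>co ` ?L. x ^ gsize c) = (\<Sum>c\<in>?L. x ^ gsize c)"
      using inj by (simp add: sum.reindex)
    then show ?thesis
      using finS finL D(1) dis by (simp add: sum.union_disjoint)
  qed
  also have "(\<Sum>c\<in>?S. x ^ gsize c) = (\<Sum>n\<le>N. real (num Z n) * x ^ n)" by (rule sum_by_gsize)
  finally have main: "1 + (\<Sum>n\<le>N. real (num Z n) * x ^ n) + (\<Sum>c\<in>?L. x ^ gsize c) + (\<Sum>d\<in>D. x ^ gsize d) \<le>
    exp (\<Sum>n\<le>N. real (num Z n) * (x ^ n + log_rem (x ^ n)))" .
  have "(\<Sum>n\<le>Suc N. real (num Z n) * x ^ n) = (\<Sum>c\<in>{c \<in> Z. gsize c \<le> Suc N}. x ^ gsize c)"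
    by (rule sum_by_gsize[symmetric])
  \<comment> \<open>\<open>K1\<close> is the only class of size 1 and accounts for the summand
    \<open>x\<close>.\<close>
  also have "\<dots> \<le> (\<Sum>c\<in>insert K1 ?L. x ^ gsize c)"
  proof (rule sum_mono2)
    show "{c \<in> Z. gsize c \<le> Suc N} \<subseteq> insert K1 ?L"
    proof
      fix c assume c: "c \<in> {c \<in> Z. gsize c \<le> Suc N}"
      then have "gsize c \<noteq> 0" using \<open>0 \<notin> Z\<close> by auto
      then consider "gsize c = 1" | "gsize c \<ge> 2" by linarith
      then show "c \<in> insert K1 ?L" using c gsize_1_iff by cases auto
    qed
  qed (use finL x in auto)
  also have "\<dots> = x + (\<Sum>c\<in>?L. x ^ gsize c)" using finL by (simp add: sum.insert_if)
  finally show ?thesis using main by linarith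
qed

text \<open>Conversely, sums of at least two connected cographs have connected complements, which
  are pairwise different by uniqueness of the decomposition and differ from \<open>K1\<close>.
  Multiplicities are first bounded by \<open>K\<close>, which then tends to infinity.\<close>

lemma lower_bound:
  fixes x :: real
  assumes x: "0 < x" "x < 1" and sm: "summable (\<lambda>n. real (num conn_cographs n) * x ^ n)"
  shows "x + exp (\<Sum>n\<le>N. real (num conn_cographs n) * (x ^ n + log_rem (x ^ n))) - 1 -
    (\<Sum>n\<le>N. real (num conn_cographs n) * x ^ n) \<le> (\<Sum>n. real (num conn_cographs n) * x ^ n)"
proof -
  let ?S = "{c \<in> conn_cographs. gsize c \<le> N}"
  let ?T = "\<Sum>n. real (num conn_cographs n) * x ^ n"
  have finS: "finite ?S" by (rule finite_gsize_le)
  have S: "gconnected s" "cograph s" if "s \<in> ?S" for s using that by (simp_all add: conn_cographs_def)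
  have bound: "x + (\<Prod>s\<in>?S. \<Sum>k\<le>K. (x ^ gsize s) ^ k) - 1 - (\<Sum>s\<in>?S. x ^ gsize s) \<le> ?T"
    if "K \<ge> 1" for K
  proof -
    let ?B = "bounded_msets ?S K"
    define R where "R = {M \<in> ?B. size M \<ge> 2}"
    note B = sum_bounded_msets[OF finS, of K "\<lambda>s. x ^ gsize s"]
    have Bs: "\<forall>s\<in>#M. gconnected s" "cograph (sum_mset M)" if "M \<in> ?B" for M
      using that S unfolding bounded_msets_def cograph_sum_mset by blast+
    have finR: "finite R" unfolding R_def using B by simp
    \<comment> \<open>\<open>K \<ge> 1\<close> admits the singletons; \<open>R\<close> holds the
      multisets with at least two components.\<close>
    have split: "?B = insert {#} ((\<lambda>s. {#s#}) ` ?S) \<union> R"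
    proof (intro equalityI subsetI)
      fix M assume M: "M \<in> ?B"
      consider "size M = 0" | "size M = 1" | "size M \<ge> 2" by linarith
      then show "M \<in> insert {#} ((\<lambda>s. {#s#}) ` ?S) \<union> R"
      proof cases
        case 2
        then obtain s where "M = {#s#}" using size_1_singleton_mset by blast
        then show ?thesis using M by (auto simp: bounded_msets_def)
      qed (use M in \<open>auto simp: R_def\<close>)
    next
      fix M assume "M \<in> insert {#} ((\<lambda>s. {#s#}) ` ?S) \<union> R"
      then show "M \<in> ?B" using \<open>K \<ge> 1\<close> by (auto simp: R_def bounded_msets_def)
    qed
    have Rsum: "\<not> gconnected (sum_mset M)" "gsize (sum_mset M) \<ge> 2" if "M \<in> R" for M
    proof -
      have c: "\<forall>s\<in>#M. gconnected s" using Bs(1) that unfolding R_def by blast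
      have size: "size M \<ge> 2" using that unfolding R_def by simp
      then obtain a M' where M': "M = add_mset a M'" by (cases M) auto
      then obtain b M'' where M'': "M' = add_mset b M''" using size by (cases M') auto
      have ab: "a \<noteq> 0" "b \<noteq> 0" using c M' M'' by (auto simp: gconnected_def)
      then have "b + sum_mset M'' \<noteq> 0" by (simp add: plus_eq_0_iff)
      then show "\<not> gconnected (sum_mset M)"
        using not_connected_plus[OF ab(1)] M' M'' by simp
      show "gsize (sum_mset M) \<ge> 2" using gsize_pos[OF ab(1)] gsize_pos[OF ab(2)] M' M'' by simp
    qed
    define G where "G = (\<lambda>M. co (sum_mset M)) ` R"
    have inj: "inj_on (\<lambda>M. co (sum_mset M)) R"
    proof (rule inj_onI)
      fix M M' assume "M \<in> R" "M' \<in> R" and eq: "co (sum_mset M) = co (sum_mset M')"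
      then have "M \<in> ?B" "M' \<in> ?B" by (simp_all add: R_def)
      moreover have "sum_mset M = sum_mset M'" using eq by (metis co_co)
      ultimately show "M = M'" using connected_sum_unique Bs(1) by blast
    qed
    have G: "G \<subseteq> conn_cographs" "K1 \<notin> G" "finite G"
    proof -
      show "G \<subseteq> conn_cographs"
        unfolding G_def
      proof (rule image_subsetI)
        fix M assume "M \<in> R"
        moreover from this have "M \<in> ?B" by (simp add: R_def)
        ultimately show "co (sum_mset M) \<in> conn_cographs" using Rsum Bs(2) by (intro co_conn)
      qed
      have "gsize g \<ge> 2" if "g \<in> G" for g using that Rsum(2) by (auto simp: G_def)
      then show "K1 \<notin> G" by force
      show "finite G" using finR by (simp add: G_def)
    qed
    \<comment> \<open>The largest size that occurs, so that one partial sum of the series covers the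
      finite set.\<close>
    define L where "L = Max (gsize ` insert K1 G)"
    have L: "gsize c \<le> L" if "c \<in> insert K1 G" for c
      unfolding L_def using that G(3) by (intro Max_ge) auto
    have "(\<Prod>s\<in>?S. \<Sum>k\<le>K. (x ^ gsize s) ^ k) = (\<Sum>M\<in>?B. x ^ gsize (sum_mset M))"
      unfolding power_gsize_sum_mset using B by simp
    also have "\<dots> = 1 + (\<Sum>s\<in>?S. x ^ gsize s) + (\<Sum>M\<in>R. x ^ gsize (sum_mset M))"
    proof -
      have "insert {#} ((\<lambda>s. {#s#}) ` ?S) \<inter> R = {}" by (auto simp: R_def)
      moreover have "(\<Sum>M\<in>insert {#} ((\<lambda>s. {#s#}) ` ?S). x ^ gsize (sum_mset M)) = 1 + (\<Sum>s\<in>?S. x ^ gsize s)"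
        using finS by (subst sum.insert) (auto simp: sum.reindex inj_on_def)
      ultimately show ?thesis unfolding split using finS finR by (subst sum.union_disjoint) auto
    qed
    also have "(\<Sum>M\<in>R. x ^ gsize (sum_mset M)) = (\<Sum>c\<in>G. x ^ gsize c)"
      unfolding G_def using inj by (simp add: sum.reindex)
    finally have "x + (\<Prod>s\<in>?S. \<Sum>k\<le>K. (x ^ gsize s) ^ k) - 1 - (\<Sum>s\<in>?S. x ^ gsize s) =
        (\<Sum>c\<in>insert K1 G. x ^ gsize c)"
      using G by simp
    also have "\<dots> \<le> (\<Sum>c\<in>{c \<in> conn_cographs. gsize c \<le> L}. x ^ gsize c)"
    proof (rule sum_mono2[OF finite_gsize_le])
      have "K1 \<in> conn_cographs" using connected_K1 cograph_K1 by (simp add: conn_cographs_def)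
      then show "insert K1 G \<subseteq> {c \<in> conn_cographs. gsize c \<le> L}" using L G(1) by blast
    qed (use x in simp)
    also have "\<dots> = (\<Sum>n\<le>L. real (num conn_cographs n) * x ^ n)" by (rule sum_by_gsize)
    also have "\<dots> \<le> ?T" using sm x by (intro sum_le_suminf) auto
    finally show ?thesis .
  qed
  have "(\<lambda>K. \<Prod>s\<in>?S. \<Sum>k\<le>K. (x ^ gsize s) ^ k) \<longlonglongrightarrow> (\<Prod>s\<in>?S. 1 / (1 - x ^ gsize s))"
  proof (rule tendsto_prod)
    fix s assume "s \<in> ?S"
    then have "s \<noteq> 0" using S(1) gconnected_def by blast
    then have "norm (x ^ gsize s) < 1" using gsize_pos[of s] x by (simp add: power_less_one_iff)
    then show "(\<lambda>K. \<Sum>k\<le>K. (x ^ gsize s) ^ k) \<longlonglongrightarrow> 1 / (1 - x ^ gsize s)"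
      using summable_LIMSEQ'[OF summable_geometric] suminf_geometric by metis
  qed
  then have "(\<lambda>K. x + (\<Prod>s\<in>?S. \<Sum>k\<le>K. (x ^ gsize s) ^ k) - 1 - (\<Sum>s\<in>?S. x ^ gsize s)) \<longlonglongrightarrow>
      x + (\<Prod>s\<in>?S. 1 / (1 - x ^ gsize s)) - 1 - (\<Sum>s\<in>?S. x ^ gsize s)"
    by (intro tendsto_diff tendsto_add tendsto_const)
  then have "x + (\<Prod>s\<in>?S. 1 / (1 - x ^ gsize s)) - 1 - (\<Sum>s\<in>?S. x ^ gsize s) \<le> ?T"
    using bound by (intro LIMSEQ_le_const2) blast+
  then show ?thesis
    using prod_by_gsize[OF x zero_notin_conn, of N] sum_by_gsize[where Z = conn_cographs and N = N and g = "\<lambda>n. x ^ n"]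
    by simp
qed

text \<open>A pair goes to \<open>co (s + u)\<close>. The decomposition determines the unordered
  pair, and the different sizes \<open>n\<close> and \<open>k\<close> tell its members
  apart.\<close>

lemma num_super:
  assumes "n \<ge> 1" "k \<ge> 1" "n \<noteq> k"
  shows "num conn_cographs n * num conn_cographs k \<le> num conn_cographs (n + k)"
proof -
  let ?A = "\<lambda>n. {c \<in> conn_cographs. gsize c = n}"
  have A: "s \<noteq> 0" "gconnected s" "cograph s" "gsize s = n" if "s \<in> ?A n" for s n
    using that by (simp_all add: conn_cographs_def gconnected_def)
  have "inj_on (\<lambda>(s, u). co (s + u)) (?A n \<times> ?A k)"
  proof (rule inj_onI)
    fix p p'
    assume p: "p \<in> ?A n \<times> ?A k" "p' \<in> ?A n \<times> ?A k"
      and eq: "(case p of (s, u) \<Rightarrow> co (s + u)) = (case p' of (s, u) \<Rightarrow> co (s + u))"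
    obtain s u s' u' where pq: "p = (s, u)" "p' = (s', u')" by (cases p, cases p')
    have su: "s \<in> ?A n" "u \<in> ?A k" "s' \<in> ?A n" "u' \<in> ?A k"
      using p unfolding pq by blast+
    have "co (s + u) = co (s' + u')" using eq by (simp add: pq)
    then have "s + u = s' + u'" by (metis co_co)
    then have "sum_mset {#s, u#} = sum_mset {#s', u'#}" by simp
    then have "{#s, u#} = {#s', u'#}"
      using A(2)[OF su(1)] A(2)[OF su(2)] A(2)[OF su(3)] A(2)[OF su(4)]
      by (intro connected_sum_unique) auto
    then have "s = s' \<and> u = u' \<or> s = u' \<and> u = s'" by (auto simp: add_eq_conv_ex)
    then show "p = p'"
      unfolding pq using A(4)[OF su(1)] A(4)[OF su(4)] assms(3) by auto
  qed
  moreover have "(\<lambda>(s, u). co (s + u)) ` (?A n \<times> ?A k) \<subseteq> ?A (n + k)"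
  proof (rule image_subsetI)
    fix p assume p: "p \<in> ?A n \<times> ?A k"
    obtain s u where pq: "p = (s, u)" by (cases p)
    have su: "s \<in> ?A n" "u \<in> ?A k" using p unfolding pq by blast+
    have "co (s + u) \<in> conn_cographs"
      using not_connected_plus[OF A(1)[OF su(1)] A(1)[OF su(2)]] A(3,4)[OF su(1)] A(3,4)[OF su(2)] assms
      by (intro co_conn) simp_all
    then show "(case p of (s, u) \<Rightarrow> co (s + u)) \<in> ?A (n + k)"
      using A(4)[OF su(1)] A(4)[OF su(2)] by (simp add: pq)
  qed
  moreover have "finite (?A (n + k))"
    by (rule finite_subset[OF _ finite_gsize[of "n + k"]]) blast
  ultimately have "card (?A n \<times> ?A k) \<le> card (?A (n + k))" by (rule card_inj_on_le)
  then show ?thesis by (simp add: num_def card_cartesian_product)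
qed

text \<open>Adding an isolated vertex and complementing leads from a connected cograph to one with
  one more vertex.\<close>

lemma num_pos:
  assumes "n \<ge> 1"
  shows "num conn_cographs n \<ge> 1"
  using assms
proof (induction n rule: dec_induct)
  case base
  have "{c \<in> conn_cographs. gsize c = 1} = {K1}"
    using gsize_1_iff connected_K1 cograph_K1 by (auto simp: conn_cographs_def)
  then show ?case by (simp add: num_def)
next
  case (step n)
  have "card {c \<in> conn_cographs. gsize c = n} \<noteq> 0" using step.IH by (simp add: num_def)
  then have "{c \<in> conn_cographs. gsize c = n} \<noteq> {}" by (metis card.empty)
  then obtain s where s: "s \<in> conn_cographs" "gsize s = n" by blast
  then have "co (s + K1) \<in> conn_cographs"
    using step.hyps cograph_K1 connected_K1 not_connected_plus[of s K1]
    by (intro co_conn) (auto simp: conn_cographs_def gconnected_def)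
  then have "co (s + K1) \<in> {c \<in> conn_cographs. gsize c = Suc n}" using s by simp
  moreover have "finite {c \<in> conn_cographs. gsize c = Suc n}"
    by (rule finite_subset[OF _ finite_gsize[of "Suc n"]]) blast
  ultimately show ?case unfolding num_def by (metis One_nat_def Suc_leI card_gt_0_iff empty_iff)
qed

section \<open>Rarity of unmated cographs\<close>

lemma gsize_mated:
  assumes "mated c"
  shows "gsize c \<ge> 2"
proof -
  obtain V E where VE: "fgraph V E" "c = cls V E" "mated_graph V E" using assms unfolding mated_def by blast
  then obtain C k where "C \<subseteq> V" "card C = 2 * k" "k > 0"
    unfolding mated_graph_def switching_set_def by blast
  moreover have "finite V" using VE(1) by (simp add: fgraph_def)
  ultimately have "2 \<le> card V" using card_mono[of V C] by linarith
  then show ?thesis using VE(1,2) by (simp add: gsize_cls)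
qed

lemma mated_summand: "s \<in># M \<Longrightarrow> mated s \<Longrightarrow> mated (sum_mset M)"
  by (metis mated_plus mset_add sum_mset.add_mset)

definition unmated :: "gclass set" where
  "unmated = {c \<in> conn_cographs. \<not> mated c}"

text \<open>The closure condition \<open>comp\<close> of \<open>upper_bound\<close> for
  \<open>unmated\<close>: a mated component would make \<open>co c\<close>, and hence
  \<open>c\<close>, mated.\<close>

lemma unmated_component:
  assumes "c \<in> unmated" "co c = sum_mset M" "s \<in># M" "gconnected s"
  shows "s \<in> unmated"
proof -
  have c: "cograph c" "\<not> mated c" using assms(1) by (simp_all add: unmated_def conn_cographs_def)
  then have "cograph (sum_mset M)" "\<not> mated (sum_mset M)"
    using assms(2) mated_co[of "co c"] by (metis cograph_co, metis co_co)
  then show ?thesis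
    using assms(3,4) mated_summand by (auto simp: unmated_def conn_cographs_def cograph_sum_mset)
qed

text \<open>A mated cograph of least size \<open>m\<close> supplies the lost summand
  \<open>x ^ m\<close>, through \<open>upper_bound\<close> with a one-element
  \<open>D\<close>.\<close>

lemma unmated_ratio: "(\<lambda>n. real (num unmated n) / real (num conn_cographs n)) \<longlonglongrightarrow> 0"
proof -
  define P where "P n \<longleftrightarrow> (\<exists>c. gsize c = n \<and> cograph c \<and> mated c)" for n
  define m where "m = (LEAST n. P n)"
  have "\<exists>n. P n" using ex_mated_cograph unfolding P_def by blast
  then have "P m" unfolding m_def by (rule LeastI_ex)
  then obtain c where c: "gsize c = m" "cograph c" "mated c" unfolding P_def by blast
  \<comment> \<open>Complementing if necessary makes the minimal mated cograph disconnected, as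
    \<open>upper_bound\<close> requires of \<open>D\<close>, and keeps it mated and of size
    \<open>m\<close>.\<close>
  define d where "d = (if gconnected c then co c else c)"
  have d: "gsize d = m" "cograph d" "mated d" "\<not> gconnected d"
    using c connected_co_iff[OF c(2) gsize_mated[OF c(3)]] mated_co[OF c(3)]
    unfolding d_def by (simp_all split: if_split)
  have min: "\<not> mated s" if "gsize s < m" "cograph s" for s
    using not_less_Least[of "gsize s" P] that unfolding m_def P_def by blast
  have fin: "finite {c \<in> Z. gsize c = n}" for Z n
    by (rule finite_subset[OF _ finite_gsize[of n]]) blast
  have le: "num unmated n \<le> num conn_cographs n" for n
    unfolding num_def by (rule card_mono[OF fin]) (auto simp: unmated_def)
  show ?thesis
  proof (rule growth_gap[where m = m])
    show "real (num conn_cographs 0) = 0"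
    proof -
      have "{c \<in> conn_cographs. gsize c = 0} = {}" using zero_notin_conn by auto
      then show ?thesis unfolding num_def by (simp only: card.empty of_nat_0)
    qed
    show "1 \<le> m" using gsize_mated[OF c(3)] c(1) by simp
    show "1 \<le> real (num conn_cographs n)" if "1 \<le> n" for n using num_pos[OF that] by simp
    show "real (num unmated n) \<le> real (num conn_cographs n)" for n using le by simp
    show "real (num conn_cographs n) * real (num conn_cographs k) \<le> real (num conn_cographs (n + k))"
      if "1 \<le> n" "1 \<le> k" "n \<noteq> k" for n k
      using num_super[OF that] by (metis of_nat_le_iff of_nat_mult)
    show "x + exp (\<Sum>n\<le>N. real (num conn_cographs n) * (x ^ n + log_rem (x ^ n))) - 1 -
        (\<Sum>n\<le>N. real (num conn_cographs n) * x ^ n) \<le> (\<Sum>n. real (num conn_cographs n) * x ^ n)"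
      if "0 < x" "x < 1" "summable (\<lambda>n. real (num conn_cographs n) * x ^ n)" for x N
      using that by (rule lower_bound)
    show "(\<Sum>n\<le>Suc N. real (num conn_cographs n) * x ^ n) \<le>
        x + exp (\<Sum>n\<le>N. real (num conn_cographs n) * (x ^ n + log_rem (x ^ n))) - 1 -
        (\<Sum>n\<le>N. real (num conn_cographs n) * x ^ n)" if "0 < x" "x < 1" for x N
    proof -
      have "s \<in> conn_cographs"
        if "c \<in> conn_cographs" "co c = sum_mset M" "s \<in># M" "gconnected s" for c s M
        using that cograph_sum_mset[of M] cograph_co[of c] unfolding conn_cographs_def by simp
      from upper_bound[where D = "{}" and N = N, OF that order_refl this] show ?thesis by simp
    qed
    show "(\<Sum>n\<le>Suc N. real (num unmated n) * x ^ n) \<le>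
        x - x ^ m + exp (\<Sum>n\<le>N. real (num unmated n) * (x ^ n + log_rem (x ^ n))) - 1 -
        (\<Sum>n\<le>N. real (num unmated n) * x ^ n)" if x: "0 < x" "x < 1" and N: "m \<le> Suc N" for x N
    proof -
      obtain M where M: "d = sum_mset M" "\<And>s. s \<in># M \<Longrightarrow> gconnected s \<and> gsize s < gsize d"
        using not_connected_components d(4) by blast
      \<comment> \<open>Components of \<open>d\<close> are smaller than \<open>m\<close>, hence
        unmated by minimality; \<open>m \<le> Suc N\<close> bounds their size by
        \<open>N\<close>.\<close>
      have "set_mset M \<subseteq> {c \<in> unmated. gsize c \<le> N}"
      proof
        fix s assume s: "s \<in># M"
        then have "cograph s" using d(2) M(1) cograph_sum_mset by blast
        then show "s \<in> {c \<in> unmated. gsize c \<le> N}"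
          using min[of s] M(2)[OF s] d(1) N by (simp add: unmated_def conn_cographs_def)
      qed
      then have sums: "\<exists>M. set_mset M \<subseteq> {c \<in> unmated. gsize c \<le> N} \<and> e = sum_mset M" if "e \<in> {d}" for e
        using that M(1) by blast
      have "d \<notin> co ` unmated"
      proof
        assume "d \<in> co ` unmated"
        then obtain c' where "c' \<in> unmated" "d = co c'" by blast
        then show False using mated_co[OF d(3)] by (simp add: unmated_def)
      qed
      then have dis: "\<not> gconnected e \<and> e \<notin> co ` unmated" if "e \<in> {d}" for e using that d(4) by blast
      have d0: "0 \<notin> {d}" using gsize_mated[OF d(3)] by auto
      have sub: "unmated \<subseteq> conn_cographs" unfolding unmated_def by blast
      have "finite {d}" by simp
      from upper_bound[OF x sub unmated_component this d0 dis sums] show ?thesis by (simp add: d(1))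
    qed
  qed simp
qed

text \<open>Of an unmated cograph and its complement, both unmated, one is connected.\<close>

lemma card_unmated_cographs:
  assumes "n \<ge> 2"
  shows "card {c. gsize c = n \<and> cograph c \<and> \<not> mated c} \<le> 2 * num unmated n"
proof -
  let ?U = "{c \<in> unmated. gsize c = n}"
  have fin: "finite ?U" by (rule finite_subset[OF _ finite_gsize[of n]]) blast
  have "{c. gsize c = n \<and> cograph c \<and> \<not> mated c} \<subseteq> ?U \<union> co ` ?U"
  proof
    fix c assume "c \<in> {c. gsize c = n \<and> cograph c \<and> \<not> mated c}"
    then have c: "gsize c = n" "cograph c" "\<not> mated c" by simp_all
    have nm: "\<not> mated (co c)"
    proof
      assume "mated (co c)"
      from mated_co[OF this] c(3) show False by simp
    qed
    show "c \<in> ?U \<union> co ` ?U"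
    proof (cases "gconnected c")
      case True
      then show ?thesis using c by (simp add: unmated_def conn_cographs_def)
    next
      case False
      then have "gconnected (co c)" using connected_co_iff[OF c(2)] c(1) assms by simp
      then have "co c \<in> ?U" using nm c by (simp add: unmated_def conn_cographs_def)
      then have "co (co c) \<in> co ` ?U" by (rule imageI)
      then show ?thesis by simp
    qed
  qed
  then have "card {c. gsize c = n \<and> cograph c \<and> \<not> mated c} \<le> card (?U \<union> co ` ?U)"
    using fin by (intro card_mono) auto
  also have "\<dots> \<le> card ?U + card (co ` ?U)" by (rule card_Un_le)
  also have "\<dots> \<le> 2 * num unmated n" using card_image_le[OF fin, of co] by (simp add: num_def)
  finally show ?thesis .
qed

theorem theorem1p2:
  shows "(\<lambda>n. real (num_cographs_mate n) / real (num_cographs n)) \<longlonglongrightarrow> 1"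
proof (rule tendsto_sandwich)
  \<comment> \<open>Passing to the smaller denominator that counts only connected cographs weakens
    the lower bound to one that \<open>unmated_ratio\<close> controls.\<close>
  have le: "num conn_cographs n \<le> num_cographs n" for n
    unfolding num_def num_cographs_eq
    by (rule card_mono) (use finite_gsize[of n] in \<open>auto simp: conn_cographs_def\<close>)
  show "\<forall>\<^sub>F n in sequentially. 1 - 2 * (real (num unmated n) / real (num conn_cographs n)) \<le>
      real (num_cographs_mate n) / real (num_cographs n)"
    using eventually_ge_at_top[of 2]
  proof eventually_elim
    case (elim n)
    have pos: "0 < num conn_cographs n" using num_pos[of n] elim by simp
    have "num_cographs n \<le> num_cographs_mate n + 2 * num unmated n"
      using num_cographs_mate_bounds(2)[of n] card_unmated_cographs[OF elim] by linarith
    then have "real (num_cographs n) \<le> real (num_cographs_mate n + 2 * num unmated n)"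
      by (rule of_nat_mono)
    then have "(real (num_cographs n) - 2 * real (num unmated n)) / real (num_cographs n) \<le>
        real (num_cographs_mate n) / real (num_cographs n)"
      by (intro divide_right_mono) simp_all
    moreover have "(real (num_cographs n) - 2 * real (num unmated n)) / real (num_cographs n) =
        1 - 2 * (real (num unmated n) / real (num_cographs n))"
      using pos le[of n] by (simp add: diff_divide_distrib)
    moreover have "real (num unmated n) / real (num_cographs n) \<le>
        real (num unmated n) / real (num conn_cographs n)"
      using pos le[of n] by (intro divide_left_mono) simp_all
    ultimately show ?case by linarith
  qed
  show "\<forall>\<^sub>F n in sequentially. real (num_cographs_mate n) / real (num_cographs n) \<le> 1"
  proof (intro always_eventually allI)
    fix n
    show "real (num_cographs_mate n) / real (num_cographs n) \<le> 1"
      using num_cographs_mate_bounds(1)[of n] by (cases "num_cographs n = 0") simp_all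
  qed
  have "(\<lambda>n. 1 - 2 * (real (num unmated n) / real (num conn_cographs n))) \<longlonglongrightarrow> 1 - 2 * 0"
    by (intro tendsto_intros unmated_ratio)
  then show "(\<lambda>n. 1 - 2 * (real (num unmated n) / real (num conn_cographs n))) \<longlonglongrightarrow> 1" by simp
qed simp

end
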